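(* Consider Problem (P) below and suppose the Sparsity Assumption and the Compactness/Generation Assumption (parts (a) and (b)) hold. Fix $k\in\mathbb N$. Then the sequence $(q^k_d)_{d\in\mathbb N}$ is monotone non-decreasing and $q^k_d\to f^*$ as $d\to\infty$.
   Context: Problem (P): $f^*=\min\{f(\mathbf x):\mathbf x\in\mathbf K\}$ with $\mathbf K=\{\mathbf x\in\mathbb R^n:0\le g_j(\mathbf x)\le 1,\ j=1,\ldots,m\}$, $f,g_j\in\mathbb R[\mathbf x]$. $\mathbb R[\mathbf x;I]$ is the ring of polynomials in $\{x_i:i\in I\}$, $\mathbb R[\mathbf x;I]_t$ those of degree $\le t$, and $\Sigma[\mathbf x;I]_k$ the sums of squares of polynomials in $\mathbb R[\mathbf x;I]_k$. Sparsity Assumption: there are $p\in\mathbb N$ and sets $I_\ell\subseteq\{1,\ldots,n\}$, $J_\ell\subseteq\{1,\ldots,m\}$ with $f=\sum_\ell f^\ell$ for some $f^\ell\in\mathbb R[\mathbf x;I_\ell]$, $g_j\in\mathbb R[\mathbf x;I_\ell]$ for $j\in J_\ell$, $\bigcup_\ell I_\ell=\{1,\ldots,n\}$, $\bigcup_\ell J_\ell=\{1,\ldots,m\}$, and for every $\ell\le p-1$ some $s\le\ell$ with $I_{\ell+1}\cap\bigcup_{r\le\ell}I_r\subseteq I_s$. Compactness/Generation Assumption: (a) for each $\ell$ the set $\mathbf K_\ell=\{\mathbf z\in\mathbb R^{|I_\ell|}:0\le g_j(\mathbf z)\le1,\ j\in J_\ell\}$ is compact and $1,(g_j)_{j\in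 J_\ell}$ generate $\mathbb R[\mathbf x;I_\ell]$ as an $\mathbb R$-algebra; (b) for each $\ell$ there exist $M_\ell>0$ and $j\in J_\ell$ with $g_j=1-M_\ell^{-1}\sum_{i\in I_\ell}x_i^2$. $h_{\alpha\beta}=\prod_j g_j^{\alpha_j}(1-g_j)^{\beta_j}$ for $\alpha,\beta\in\mathbb N_0^m$; $N^\ell_d=\{(\alpha,\beta)\in\mathbb N_0^m\times\mathbb N_0^m:\mathrm{supp}(\alpha)\cup\mathrm{supp}(\beta)\subseteq J_\ell,\ \sum_j(\alpha_j+\beta_j)\le d\}$; $d_{\max}=\max\{\deg f,2k,d\max_j\deg g_j\}$. $q^k_d=\sup\{t: f-t=\sum_{\ell=1}^p f^\ell,\ f^\ell\in\mathbb R[\mathbf x;I_\ell]_{d_{\max}},\ f^\ell-\sum_{(\alpha,\beta)\in N^\ell_d}\lambda^\ell_{\alpha\beta}h_{\alpha\beta}\in\Sigma[\mathbf x;I_\ell]_k,\ \lambda^\ell_{\alpha\beta}\ge0,\ t\in\mathbb R\}$, where the $f^\ell$, $\lambda^\ell$, $t$ are decision variables. *)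

theory Defs
  imports "HOL-Analysis.Analysis" "HOL-Library.Poly_Mapping" "HOL-Library.Extended_Real"
begin

text \<open>Multivariate real polynomials: finitely supported maps from monomials
(finitely supported exponent vectors, variable index nat) to real coefficients.
This is a commutative ring with the convolution product of Poly_Mapping.\<close>

type_synonym mpoly = "(nat \<Rightarrow>\<^sub>0 nat) \<Rightarrow>\<^sub>0 real"

definition mconst :: "real \<Rightarrow> mpoly" where
  "mconst c = Poly_Mapping.single 0 c"

definition mvar :: "nat \<Rightarrow> mpoly" where
  "mvar i = Poly_Mapping.single (Poly_Mapping.single i 1) 1"

definition mon_deg :: "(nat \<Rightarrow>\<^sub>0 nat) \<Rightarrow> nat" where
  "mon_deg \<mu> = (\<Sum>i\<in>Poly_Mapping.keys \<mu>. Poly_Mapping.lookup \<mu> i)"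

definition mdeg :: "mpoly \<Rightarrow> nat" where
  "mdeg p = Max (insert 0 (mon_deg ` Poly_Mapping.keys p))"

definition mpeval :: "mpoly \<Rightarrow> (nat \<Rightarrow> real) \<Rightarrow> real" where
  "mpeval p x = (\<Sum>\<mu>\<in>Poly_Mapping.keys p. Poly_Mapping.lookup p \<mu> * (\<Prod>i\<in>Poly_Mapping.keys \<mu>. x i ^ Poly_Mapping.lookup \<mu> i))"

definition polys_in :: "nat set \<Rightarrow> mpoly set" where
  "polys_in I = {p. \<forall>\<mu>\<in>Poly_Mapping.keys p. Poly_Mapping.keys \<mu> \<subseteq> I}"

definition polys_deg :: "nat set \<Rightarrow> nat \<Rightarrow> mpoly set" where
  "polys_deg I t = {p. p \<in> polys_in I \<and> mdeg p \<le> t}"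

definition sos_set :: "nat set \<Rightarrow> nat \<Rightarrow> mpoly set" where
  "sos_set I k = {s. \<exists>qs. set qs \<subseteq> polys_deg I k \<and> s = sum_list (map (\<lambda>q. q * q) qs)}"

inductive_set alg_gen :: "mpoly set \<Rightarrow> mpoly set" for G where
  const: "mconst c \<in> alg_gen G"
| gen: "p \<in> G \<Longrightarrow> p \<in> alg_gen G"
| add: "p \<in> alg_gen G \<Longrightarrow> q \<in> alg_gen G \<Longrightarrow> p + q \<in> alg_gen G"
| mult: "p \<in> alg_gen G \<Longrightarrow> q \<in> alg_gen G \<Longrightarrow> p * q \<in> alg_gen G"

definition Kset :: "nat \<Rightarrow> nat \<Rightarrow> (nat \<Rightarrow> mpoly) \<Rightarrow> (nat \<Rightarrow> real) set" where
  "Kset n m g = {x. (\<forall>i. i \<notin> {1..n} \<longrightarrow> x i = 0) \<and>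
      (\<forall>j\<in>{1..m}. 0 \<le> mpeval (g j) x \<and> mpeval (g j) x \<le> 1)}"

definition Kloc :: "nat set \<Rightarrow> nat set \<Rightarrow> (nat \<Rightarrow> mpoly) \<Rightarrow> (nat \<Rightarrow> real) set" where
  "Kloc Il Jl g = {z. (\<forall>i. i \<notin> Il \<longrightarrow> z i = 0) \<and>
      (\<forall>j\<in>Jl. 0 \<le> mpeval (g j) z \<and> mpeval (g j) z \<le> 1)}"

text \<open>f^* = inf of f over K (in the extended reals; +infinity if K is empty).\<close>
definition fstar :: "nat \<Rightarrow> nat \<Rightarrow> mpoly \<Rightarrow> (nat \<Rightarrow> mpoly) \<Rightarrow> ereal" where
  "fstar n m f g = Inf {ereal (mpeval f x) | x. x \<in> Kset n m g}"

definition hab :: "nat \<Rightarrow> (nat \<Rightarrow> mpoly) \<Rightarrow> (nat \<Rightarrow> nat) \<Rightarrow> (nat \<Rightarrow> nat) \<Rightarrow> mpoly" where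
  "hab m g \<alpha> \<beta> = (\<Prod>j\<in>{1..m}. g j ^ \<alpha> j * (1 - g j) ^ \<beta> j)"

definition Nset :: "nat set \<Rightarrow> nat \<Rightarrow> ((nat \<Rightarrow> nat) \<times> (nat \<Rightarrow> nat)) set" where
  "Nset Jl d = {(\<alpha>, \<beta>). (\<forall>j. j \<notin> Jl \<longrightarrow> \<alpha> j = 0 \<and> \<beta> j = 0) \<and>
      (\<Sum>j\<in>Jl. \<alpha> j + \<beta> j) \<le> d}"

definition dmax :: "nat \<Rightarrow> mpoly \<Rightarrow> (nat \<Rightarrow> mpoly) \<Rightarrow> nat \<Rightarrow> nat \<Rightarrow> nat" where
  "dmax m f g k d = max (mdeg f) (max (2 * k) (d * Max (insert 0 (mdeg ` g ` {1..m}))))"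

text \<open>q^k_d (in the extended reals; -infinity if infeasible).\<close>
definition qkd :: "nat \<Rightarrow> nat \<Rightarrow> (nat \<Rightarrow> nat set) \<Rightarrow> (nat \<Rightarrow> nat set) \<Rightarrow> mpoly \<Rightarrow>
    (nat \<Rightarrow> mpoly) \<Rightarrow> nat \<Rightarrow> nat \<Rightarrow> ereal" where
  "qkd m p I J f g k d = Sup {ereal t | t. \<exists>(F :: nat \<Rightarrow> mpoly)
      (lam :: nat \<Rightarrow> (nat \<Rightarrow> nat) \<times> (nat \<Rightarrow> nat) \<Rightarrow> real).
      f - mconst t = (\<Sum>l\<in>{1..p}. F l) \<and>
      (\<forall>l\<in>{1..p}. F l \<in> polys_deg (I l) (dmax m f g k d) \<and>
         (\<forall>ab\<in>Nset (J l) d. 0 \<le> lam l ab) \<and>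
         F l - (\<Sum>ab\<in>Nset (J l) d. mconst (lam l ab) * hab m g (fst ab) (snd ab))
           \<in> sos_set (I l) k)}"

end

theory Submission
  imports Defs "HOL-Real_Asymp.Real_Asymp"
begin

text \<open>Positivity of \<open>f - t\<close> on \<open>K\<close> is first distributed over the blocks: a continuous penalty
  makes the sum positive on a whole box, where minimising a summand over the variables it does not
  share with the other blocks yields a continuous function; the running intersection property and
  Stone--Weierstrass then allow splitting \<open>f - t\<close> into polynomials \<open>p\<^sub>l\<close> in the variables of \<open>I l\<close>,
  positive on the local sets \<open>Kloc\<close>. Each \<open>p\<^sub>l\<close> is a polynomial in the generators \<open>g\<^sub>j\<close>; modifying it
  by relations among them makes it positive on the unit cube, and then its Bernstein coefficients of
  high degree are nonnegative.\<close>

subsection \<open>Arithmetic and evaluation of multivariate polynomials\<close>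

text \<open>Two obstacles shape the argument. First, positivity on \<open>Kset\<close> says nothing
  about the individual summands \<open>fl l\<close>, so something must be moved between blocks, and
  only through polynomials in variables that both blocks own. The amount to move is a minimum over
  fibres; over \<open>Kset\<close> the fibres change with the base point and this minimum need not
  be continuous, whereas over a box all fibres are the same set. This is why the constraints are
  first traded for a penalty. It need not be polynomial: it vanishes on the local sets, and only the
  polynomial corrections enter the certificates. Secondly, \<open>qkd\<close> asks for equality of
  formal polynomials, not of functions on a set. Bernstein expansions are therefore used as
  identities in the polynomial ring, with the \<open>g j\<close> substituted for the variables, and
  analysis only decides the signs of their coefficients. These approach the values of the
  represented function at the grid points \<open>a / N\<close>, so strict positivity on the cube
  suffices.\<close>

definition mon_eval :: "(nat \<Rightarrow>\<^sub>0 nat) \<Rightarrow> (nat \<Rightarrow> real) \<Rightarrow> real" where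
  "mon_eval \<mu> x = (\<Prod>i\<in>Poly_Mapping.keys \<mu>. x i ^ Poly_Mapping.lookup \<mu> i)"

lemma mon_eval_superset:
  assumes "finite A" "Poly_Mapping.keys \<mu> \<subseteq> A"
  shows "mon_eval \<mu> x = (\<Prod>i\<in>A. x i ^ Poly_Mapping.lookup \<mu> i)"
  unfolding mon_eval_def
  by (rule prod.mono_neutral_left) (use assms in \<open>auto simp: in_keys_iff\<close>)

lemma mon_eval_add: "mon_eval (\<mu> + \<nu>) x = mon_eval \<mu> x * mon_eval \<nu> x"
proof -
  let ?A = "Poly_Mapping.keys \<mu> \<union> Poly_Mapping.keys \<nu>"
  have "finite ?A" by simp
  then show ?thesis
    using Poly_Mapping.keys_add[of \<mu> \<nu>]
    by (simp add: mon_eval_superset[of ?A] lookup_add power_add prod.distrib)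
qed

lemma poly_mapping_sum_single:
  "p = (\<Sum>\<mu>\<in>Poly_Mapping.keys p. Poly_Mapping.single \<mu> (Poly_Mapping.lookup p \<mu>))"
  by (rule poly_mapping_eqI)
     (simp add: lookup_sum lookup_single when_def in_keys_iff)

lemma mpeval_mon: "mpeval p x = (\<Sum>\<mu>\<in>Poly_Mapping.keys p. Poly_Mapping.lookup p \<mu> * mon_eval \<mu> x)"
  by (simp add: mpeval_def mon_eval_def)

lemma mpeval_add: "mpeval (p + q) x = mpeval p x + mpeval q x"
  unfolding mpeval_mon
  using setsum_keys_plus_distrib[of "\<lambda>\<mu> c. c * mon_eval \<mu> x" p q]
  by (simp add: distrib_right)

lemma mpeval_single: "mpeval (Poly_Mapping.single \<mu> c) x = c * mon_eval \<mu> x"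
  by (simp add: mpeval_mon)

lemma mpeval_zero [simp]: "mpeval 0 x = 0"
  by (simp add: mpeval_def)

lemma mpeval_sum: "mpeval (sum h A) x = (\<Sum>a\<in>A. mpeval (h a) x)"
  by (induction A rule: infinite_finite_induct) (simp_all add: mpeval_add)

lemma mpeval_mult: "mpeval (p * q) x = mpeval p x * mpeval q x"
proof -
  let ?c = Poly_Mapping.lookup
  have "p * q = (\<Sum>\<mu>\<in>Poly_Mapping.keys p. Poly_Mapping.single \<mu> (?c p \<mu>)) *
      (\<Sum>\<nu>\<in>Poly_Mapping.keys q. Poly_Mapping.single \<nu> (?c q \<nu>))"
    by (simp flip: poly_mapping_sum_single)
  then have "mpeval (p * q) x = (\<Sum>\<mu>\<in>Poly_Mapping.keys p. \<Sum>\<nu>\<in>Poly_Mapping.keys q.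
      (?c p \<mu> * ?c q \<nu>) * (mon_eval \<mu> x * mon_eval \<nu> x))"
    by (simp add: sum_product mult_single mpeval_sum mpeval_single mon_eval_add)
  also have "\<dots> = mpeval p x * mpeval q x"
    by (simp add: mpeval_mon sum_product algebra_simps)
  finally show ?thesis .
qed

lemma mpeval_mconst [simp]: "mpeval (mconst c) x = c"
  by (simp add: mconst_def mpeval_single mon_eval_def)

lemma mpeval_mvar [simp]: "mpeval (mvar i) x = x i"
  by (simp add: mvar_def mpeval_single mon_eval_def)

lemma mconst_zero [simp]: "mconst 0 = 0" and mconst_one: "mconst 1 = 1"
  by (simp_all add: mconst_def)

lemma mconst_add: "mconst (a + b) = mconst a + mconst b"
  by (simp add: mconst_def single_add)

lemma mconst_uminus: "mconst (- a) = - mconst a"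
  by (simp add: mconst_def single_uminus)

lemma mconst_mult: "mconst (a * b) = mconst a * mconst b"
  by (simp add: mconst_def mult_single)

lemma mconst_prod: "mconst (prod h A) = (\<Prod>a\<in>A. mconst (h a))"
  by (induction A rule: infinite_finite_induct) (simp_all add: mconst_one mconst_mult)

lemma mconst_of_nat: "mconst (of_nat n) = of_nat n"
  by (induction n) (simp_all add: mconst_one mconst_add)

lemma mpeval_one [simp]: "mpeval 1 x = 1"
  by (simp flip: mconst_one)

lemma mpeval_diff: "mpeval (p - q) x = mpeval p x - mpeval q x"
  using mpeval_add[of "p - q" q x] by simp

lemma mpeval_power: "mpeval (p ^ e) x = mpeval p x ^ e"
  by (induction e) (simp_all add: mpeval_mult)

lemma mpeval_prod: "mpeval (prod h A) x = (\<Prod>a\<in>A. mpeval (h a) x)"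
  by (induction A rule: infinite_finite_induct) (simp_all add: mpeval_mult)

lemma mpeval_sum_list: "mpeval (sum_list ps) x = (\<Sum>p\<leftarrow>ps. mpeval p x)"
  by (induction ps) (simp_all add: mpeval_add)

lemma mpeval_cong:
  assumes "p \<in> polys_in A" "\<And>i. i \<in> A \<Longrightarrow> x i = y i"
  shows "mpeval p x = mpeval p y"
  unfolding mpeval_def
  by (intro sum.cong prod.cong arg_cong2[where f = "(*)"] refl)
     (use assms in \<open>auto simp: polys_in_def subset_iff\<close>)

lemma continuous_on_mpeval [continuous_intros]: "continuous_on S (mpeval p)"
proof -
  have "continuous_on UNIV (\<lambda>x. mpeval p x)"
    unfolding mpeval_def by (intro continuous_intros continuous_on_product_coordinates)
  then show ?thesis by (rule continuous_on_subset) simp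
qed

section \<open>Polynomials in a given set of variables, and generated subalgebras\<close>

lemma polys_in_mconst [simp]: "mconst c \<in> polys_in A"
  by (simp add: polys_in_def mconst_def)

lemma polys_in_zero [simp]: "0 \<in> polys_in A"
  by (simp add: polys_in_def)

lemma polys_in_one [simp]: "1 \<in> polys_in A"
  by (simp flip: mconst_one)

lemma polys_in_mvar: "i \<in> A \<Longrightarrow> mvar i \<in> polys_in A"
  by (simp add: polys_in_def mvar_def)

lemma polys_in_add: "p \<in> polys_in A \<Longrightarrow> q \<in> polys_in A \<Longrightarrow> p + q \<in> polys_in A"
  using Poly_Mapping.keys_add[of p q] unfolding polys_in_def by blast

lemma polys_in_uminus: "p \<in> polys_in A \<Longrightarrow> - p \<in> polys_in A"
  by (simp add: polys_in_def)

lemma polys_in_diff: "p \<in> polys_in A \<Longrightarrow> q \<in> polys_in A \<Longrightarrow> p - q \<in> polys_in A"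
  using polys_in_add[of p A "- q"] by (simp add: polys_in_uminus)

lemma polys_in_mult:
  assumes "p \<in> polys_in A" "q \<in> polys_in A"
  shows "p * q \<in> polys_in A"
  unfolding polys_in_def
proof (intro CollectI ballI)
  fix \<mu> assume "\<mu> \<in> Poly_Mapping.keys (p * q)"
  then obtain a b where "\<mu> = a + b" "a \<in> Poly_Mapping.keys p" "b \<in> Poly_Mapping.keys q"
    using Poly_Mapping.keys_mult[of p q] by blast
  then show "Poly_Mapping.keys \<mu> \<subseteq> A"
    using assms Poly_Mapping.keys_add[of a b] unfolding polys_in_def by blast
qed

lemma polys_in_sum: "(\<And>a. a \<in> S \<Longrightarrow> h a \<in> polys_in A) \<Longrightarrow> sum h S \<in> polys_in A"
  by (induction S rule: infinite_finite_induct) (auto intro: polys_in_add)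

lemma polys_in_prod: "(\<And>a. a \<in> S \<Longrightarrow> h a \<in> polys_in A) \<Longrightarrow> prod h S \<in> polys_in A"
  by (induction S rule: infinite_finite_induct) (auto intro: polys_in_mult)

lemma polys_in_power: "p \<in> polys_in A \<Longrightarrow> p ^ e \<in> polys_in A"
  by (induction e) (auto intro: polys_in_mult)

lemma polys_in_mono: "A \<subseteq> B \<Longrightarrow> polys_in A \<subseteq> polys_in B"
  unfolding polys_in_def by blast

lemma alg_gen_sum: "(\<And>a. a \<in> S \<Longrightarrow> h a \<in> alg_gen G) \<Longrightarrow> sum h S \<in> alg_gen G"
  using alg_gen.const[of 0 G]
  by (induction S rule: infinite_finite_induct) (auto intro: alg_gen.add)

lemma alg_gen_power: "p \<in> alg_gen G \<Longrightarrow> p ^ e \<in> alg_gen G"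
  using alg_gen.const[of 1 G]
  by (induction e) (auto intro: alg_gen.mult simp: mconst_one)

lemma single_single_eq_power_mvar: "Poly_Mapping.single (Poly_Mapping.single i e) 1 = mvar i ^ e"
proof (induction e)
  case (Suc e)
  have "mvar i ^ Suc e = mvar i * Poly_Mapping.single (Poly_Mapping.single i e) 1"
    by (simp add: Suc)
  also have "\<dots> = Poly_Mapping.single (Poly_Mapping.single i 1 + Poly_Mapping.single i e) 1"
    by (simp add: mvar_def mult_single)
  finally show ?case by (simp flip: single_add)
qed simp

lemma single_in_alg_gen_mvar:
  "Poly_Mapping.keys \<mu> \<subseteq> A \<Longrightarrow> Poly_Mapping.single \<mu> c \<in> alg_gen (mvar ` A)"
proof (induction \<mu> rule: update_induct)
  case const
  then show ?case using alg_gen.const[of c] by (simp add: mconst_def)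
next
  case (update \<mu> i e)
  \<comment> \<open>Since \<open>i\<close> is a new key, the update is an addition of exponent
    vectors, that is, a multiplication of monomials.\<close>
  have "Poly_Mapping.update i e \<mu> = \<mu> + Poly_Mapping.single i e"
    using update.hyps
    by (intro poly_mapping_eqI) (auto simp: lookup_update lookup_add lookup_single in_keys_iff when_def)
  then have "Poly_Mapping.single (Poly_Mapping.update i e \<mu>) c = Poly_Mapping.single \<mu> c * mvar i ^ e"
    by (simp add: mult_single flip: single_single_eq_power_mvar)
  moreover have "i \<in> A" "Poly_Mapping.keys \<mu> \<subseteq> A"
    using update.prems update.hyps by (auto simp: keys_update split: if_splits)
  ultimately show ?case
    using update.IH by (simp add: alg_gen.mult alg_gen_power alg_gen.gen)
qed

text \<open>Makes the induction principle of \<open>alg_gen\<close> available for all polynomials,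
  so that substituting for the variables can be treated one ring operation at a time.\<close>

lemma polys_in_subset_alg_gen_mvar: "polys_in A \<subseteq> alg_gen (mvar ` A)"
proof
  fix p assume "p \<in> polys_in A"
  then show "p \<in> alg_gen (mvar ` A)"
    by (subst poly_mapping_sum_single, intro alg_gen_sum single_in_alg_gen_mvar)
       (auto simp: polys_in_def)
qed

section \<open>Total degree\<close>

lemma mdeg_le_iff: "mdeg p \<le> t \<longleftrightarrow> (\<forall>\<mu>\<in>Poly_Mapping.keys p. mon_deg \<mu> \<le> t)"
  by (simp add: mdeg_def)

lemma mon_deg_superset:
  assumes "finite A" "Poly_Mapping.keys \<mu> \<subseteq> A"
  shows "mon_deg \<mu> = (\<Sum>i\<in>A. Poly_Mapping.lookup \<mu> i)"
  unfolding mon_deg_def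
  by (rule sum.mono_neutral_left) (use assms in \<open>auto simp: in_keys_iff\<close>)

lemma mon_deg_add: "mon_deg (\<mu> + \<nu>) = mon_deg \<mu> + mon_deg \<nu>"
proof -
  let ?A = "Poly_Mapping.keys \<mu> \<union> Poly_Mapping.keys \<nu>"
  have "finite ?A" by simp
  then show ?thesis
    using Poly_Mapping.keys_add[of \<mu> \<nu>]
    by (simp add: mon_deg_superset[of ?A] lookup_add sum.distrib)
qed

lemma mdeg_add: "mdeg p \<le> t \<Longrightarrow> mdeg q \<le> t \<Longrightarrow> mdeg (p + q) \<le> t"
  unfolding mdeg_le_iff using Poly_Mapping.keys_add[of p q] by blast

lemma mdeg_diff: "mdeg p \<le> t \<Longrightarrow> mdeg q \<le> t \<Longrightarrow> mdeg (p - q) \<le> t"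
  unfolding mdeg_le_iff using Poly_Mapping.keys_diff[of p q] by blast

lemma mdeg_mconst [simp]: "mdeg (mconst c) = 0"
  using mdeg_le_iff[of "mconst c" 0] by (simp add: mconst_def mon_deg_def)

lemma mdeg_one [simp]: "mdeg 1 = 0"
  by (simp flip: mconst_one)

lemma mdeg_zero [simp]: "mdeg 0 = 0"
  by (simp add: mdeg_def)

lemma mdeg_sum: "(\<And>a. a \<in> S \<Longrightarrow> mdeg (h a) \<le> t) \<Longrightarrow> mdeg (sum h S) \<le> t"
  by (induction S rule: infinite_finite_induct) (auto intro: mdeg_add)

lemma mdeg_mult: "mdeg (p * q) \<le> mdeg p + mdeg q"
  unfolding mdeg_le_iff
proof
  fix \<mu> assume "\<mu> \<in> Poly_Mapping.keys (p * q)"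
  then obtain a b where "\<mu> = a + b" "a \<in> Poly_Mapping.keys p" "b \<in> Poly_Mapping.keys q"
    using Poly_Mapping.keys_mult[of p q] by blast
  then show "mon_deg \<mu> \<le> mdeg p + mdeg q"
    using mdeg_le_iff[of p "mdeg p"] mdeg_le_iff[of q "mdeg q"]
    by (simp add: mon_deg_add add_mono)
qed

lemma mdeg_power: "mdeg (p ^ e) \<le> e * mdeg p"
  by (induction e) (auto intro: order_trans[OF mdeg_mult])

lemma mdeg_prod: "mdeg (prod h S) \<le> (\<Sum>a\<in>S. mdeg (h a))"
  by (induction S rule: infinite_finite_induct) (auto intro: order_trans[OF mdeg_mult])

subsection \<open>The cone of products and the relaxation values\<close>

text \<open>The certificates available to one block at level \<open>d\<close> when its sum of
  squares is zero.\<close>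

definition hcone :: "nat \<Rightarrow> (nat \<Rightarrow> mpoly) \<Rightarrow> nat set \<Rightarrow> nat \<Rightarrow> mpoly set" where
  "hcone m g Jl d = {\<Sum>ab\<in>Nset Jl d. mconst (lam ab) * hab m g (fst ab) (snd ab) | lam.
     \<forall>ab\<in>Nset Jl d. (0::real) \<le> lam ab}"

lemma finite_Nset:
  assumes "finite Jl"
  shows "finite (Nset Jl d)"
proof -
  let ?F = "{\<alpha>::nat \<Rightarrow> nat. \<forall>j. (j \<in> Jl \<longrightarrow> \<alpha> j \<in> {..d}) \<and> (j \<notin> Jl \<longrightarrow> \<alpha> j = 0)}"
  have "\<alpha> j \<le> d \<and> \<beta> j \<le> d" if "(\<alpha>, \<beta>) \<in> Nset Jl d" "j \<in> Jl" for \<alpha> \<beta> j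
    using that member_le_sum[of j Jl "\<lambda>j. \<alpha> j + \<beta> j"] assms by (auto simp: Nset_def)
  then have "Nset Jl d \<subseteq> ?F \<times> ?F"
    by (auto simp: Nset_def)
  moreover have "finite ?F"
    using assms by (intro finite_set_of_finite_funs) auto
  ultimately show ?thesis
    by (meson finite_SigmaI finite_subset)
qed

lemma Nset_mono: "d \<le> d' \<Longrightarrow> Nset Jl d \<subseteq> Nset Jl d'"
  by (auto simp: Nset_def)

lemma hcone_zero: "0 \<in> hcone m g Jl d"
  unfolding hcone_def by (rule CollectI, rule exI[of _ "\<lambda>_. 0"]) simp

lemma hcone_single:
  assumes "finite Jl" "(\<alpha>, \<beta>) \<in> Nset Jl d" "0 \<le> c"
  shows "mconst c * hab m g \<alpha> \<beta> \<in> hcone m g Jl d"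
  unfolding hcone_def
proof (rule CollectI, rule exI[of _ "\<lambda>ab. if ab = (\<alpha>, \<beta>) then c else 0"])
  have "(\<Sum>ab\<in>Nset Jl d. mconst (if ab = (\<alpha>, \<beta>) then c else 0) * hab m g (fst ab) (snd ab)) =
      (\<Sum>ab\<in>Nset Jl d. if ab = (\<alpha>, \<beta>) then mconst c * hab m g \<alpha> \<beta> else 0)"
    by (rule sum.cong) auto
  also have "\<dots> = mconst c * hab m g \<alpha> \<beta>"
    using assms finite_Nset by simp
  finally show "mconst c * hab m g \<alpha> \<beta> =
      (\<Sum>ab\<in>Nset Jl d. mconst (if ab = (\<alpha>, \<beta>) then c else 0) * hab m g (fst ab) (snd ab)) \<and>
      (\<forall>ab\<in>Nset Jl d. 0 \<le> (if ab = (\<alpha>, \<beta>) then c else 0))"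
    using assms by simp
qed

lemma hcone_add:
  assumes "P \<in> hcone m g Jl d" "Q \<in> hcone m g Jl d"
  shows "P + Q \<in> hcone m g Jl d"
proof -
  from assms obtain lam lam' :: "(nat \<Rightarrow> nat) \<times> (nat \<Rightarrow> nat) \<Rightarrow> real" where
    "P = (\<Sum>ab\<in>Nset Jl d. mconst (lam ab) * hab m g (fst ab) (snd ab))"
    "\<forall>ab\<in>Nset Jl d. 0 \<le> lam ab"
    "Q = (\<Sum>ab\<in>Nset Jl d. mconst (lam' ab) * hab m g (fst ab) (snd ab))"
    "\<forall>ab\<in>Nset Jl d. 0 \<le> lam' ab"
    unfolding hcone_def by auto
  then show ?thesis
    unfolding hcone_def
    by (intro CollectI exI[of _ "\<lambda>ab. lam ab + lam' ab"])
       (simp add: mconst_add distrib_right sum.distrib)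
qed

lemma hcone_sum: "(\<And>a. a \<in> S \<Longrightarrow> h a \<in> hcone m g Jl d) \<Longrightarrow> sum h S \<in> hcone m g Jl d"
  by (induction S rule: infinite_finite_induct) (auto intro: hcone_add hcone_zero)

lemma hcone_mono:
  assumes "finite Jl" "d \<le> d'"
  shows "hcone m g Jl d \<subseteq> hcone m g Jl d'"
proof
  fix P assume "P \<in> hcone m g Jl d"
  then obtain lam :: "(nat \<Rightarrow> nat) \<times> (nat \<Rightarrow> nat) \<Rightarrow> real" where lam:
    "P = (\<Sum>ab\<in>Nset Jl d. mconst (lam ab) * hab m g (fst ab) (snd ab))"
    "\<forall>ab\<in>Nset Jl d. 0 \<le> lam ab"
    unfolding hcone_def by auto
  have "mconst (lam ab) * hab m g (fst ab) (snd ab) \<in> hcone m g Jl d'" if "ab \<in> Nset Jl d" for ab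
    using that Nset_mono[OF assms(2), of Jl] lam(2) assms(1)
    by (intro hcone_single) auto
  then show "P \<in> hcone m g Jl d'"
    unfolding lam(1) by (rule hcone_sum)
qed

lemma polys_in_hab:
  assumes "\<And>j. j \<in> Jl \<Longrightarrow> g j \<in> polys_in A" "(\<alpha>, \<beta>) \<in> Nset Jl d"
  shows "hab m g \<alpha> \<beta> \<in> polys_in A"
  unfolding hab_def
proof (rule polys_in_prod)
  fix j
  show "g j ^ \<alpha> j * (1 - g j) ^ \<beta> j \<in> polys_in A"
  proof (cases "j \<in> Jl")
    case True
    then show ?thesis
      using assms by (intro polys_in_mult polys_in_power polys_in_diff) auto
  next
    case False
    then have "\<alpha> j = 0" "\<beta> j = 0" using assms(2) by (auto simp: Nset_def)
    then show ?thesis by simp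
  qed
qed

lemma mdeg_hab:
  assumes "Jl \<subseteq> {1..m}" "(\<alpha>, \<beta>) \<in> Nset Jl d"
  shows "mdeg (hab m g \<alpha> \<beta>) \<le> d * Max (insert 0 (mdeg ` g ` {1..m}))"
proof -
  let ?D = "Max (insert 0 (mdeg ` g ` {1..m}))"
  have "mdeg (hab m g \<alpha> \<beta>) \<le> (\<Sum>j\<in>{1..m}. mdeg (g j ^ \<alpha> j * (1 - g j) ^ \<beta> j))"
    unfolding hab_def by (rule mdeg_prod)
  also have "\<dots> \<le> (\<Sum>j\<in>{1..m}. (\<alpha> j + \<beta> j) * ?D)"
  proof (rule sum_mono)
    fix j assume j: "j \<in> {1..m}"
    have D: "mdeg (g j) \<le> ?D" using j by (intro Max_ge) auto
    then have "mdeg (1 - g j) \<le> ?D" by (intro mdeg_diff) auto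
    with D have "mdeg (g j ^ \<alpha> j) \<le> \<alpha> j * ?D" "mdeg ((1 - g j) ^ \<beta> j) \<le> \<beta> j * ?D"
      by (meson mdeg_power mult_le_mono2 order_trans)+
    then show "mdeg (g j ^ \<alpha> j * (1 - g j) ^ \<beta> j) \<le> (\<alpha> j + \<beta> j) * ?D"
      using mdeg_mult[of "g j ^ \<alpha> j" "(1 - g j) ^ \<beta> j"] by (simp add: distrib_right)
  qed
  also have "\<dots> = (\<Sum>j\<in>{1..m}. \<alpha> j + \<beta> j) * ?D"
    by (simp add: sum_distrib_right)
  also have "(\<Sum>j\<in>{1..m}. \<alpha> j + \<beta> j) = (\<Sum>j\<in>Jl. \<alpha> j + \<beta> j)"
    using assms by (intro sum.mono_neutral_right) (auto simp: Nset_def)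
  also have "(\<Sum>j\<in>Jl. \<alpha> j + \<beta> j) * ?D \<le> d * ?D"
    using assms(2) by (intro mult_le_mono1) (auto simp: Nset_def)
  finally show ?thesis .
qed

text \<open>A product in the cone has at most \<open>d\<close> factors, none of degree above the
  largest degree of a \<open>g j\<close>. The degree restriction in \<open>qkd\<close> therefore
  holds automatically for certificates from the cone.\<close>

lemma hcone_subset_polys_deg:
  assumes "Jl \<subseteq> {1..m}" "\<And>j. j \<in> Jl \<Longrightarrow> g j \<in> polys_in A"
  shows "hcone m g Jl d \<subseteq> polys_deg A (dmax m f g k d)"
proof
  fix P assume "P \<in> hcone m g Jl d"
  then obtain lam :: "(nat \<Rightarrow> nat) \<times> (nat \<Rightarrow> nat) \<Rightarrow> real" where lam:
    "P = (\<Sum>ab\<in>Nset Jl d. mconst (lam ab) * hab m g (fst ab) (snd ab))"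
    unfolding hcone_def by auto
  let ?h = "\<lambda>ab. hab m g (fst ab) (snd ab)"
  have "mconst (lam ab) * ?h ab \<in> polys_in A \<and> mdeg (mconst (lam ab) * ?h ab) \<le> dmax m f g k d"
    if ab: "ab \<in> Nset Jl d" for ab
  proof
    show "mconst (lam ab) * ?h ab \<in> polys_in A"
      using ab assms by (intro polys_in_mult polys_in_mconst polys_in_hab) auto
    have "mdeg (?h ab) \<le> dmax m f g k d"
      using mdeg_hab[OF assms(1), of "fst ab" "snd ab" d g] ab by (simp add: dmax_def le_max_iff_disj)
    then show "mdeg (mconst (lam ab) * ?h ab) \<le> dmax m f g k d"
      using mdeg_mult[of "mconst (lam ab)" "?h ab"] by simp
  qed
  then show "P \<in> polys_deg A (dmax m f g k d)"
    unfolding lam polys_deg_def by (auto intro!: polys_in_sum mdeg_sum)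
qed

text \<open>With the empty list of squares in every block, a decomposition into members of the cones
  is a feasible point of \<open>qkd\<close>.\<close>

lemma qkd_lower_bound:
  assumes "f - mconst t = (\<Sum>l\<in>{1..p}. F l)"
    and F: "\<And>l. l \<in> {1..p} \<Longrightarrow> F l \<in> hcone m g (J l) d"
    and J: "\<And>l. l \<in> {1..p} \<Longrightarrow> J l \<subseteq> {1..m}"
    and g: "\<And>l j. l \<in> {1..p} \<Longrightarrow> j \<in> J l \<Longrightarrow> g j \<in> polys_in (I l)"
  shows "ereal t \<le> qkd m p I J f g k d"
proof -
  have "\<forall>l\<in>{1..p}. \<exists>lam. F l = (\<Sum>ab\<in>Nset (J l) d. mconst (lam ab) * hab m g (fst ab) (snd ab)) \<and>
      (\<forall>ab\<in>Nset (J l) d. 0 \<le> lam ab)"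
    using F unfolding hcone_def by blast
  from bchoice[OF this] obtain lam where lam: "\<forall>l\<in>{1..p}.
      F l = (\<Sum>ab\<in>Nset (J l) d. mconst (lam l ab) * hab m g (fst ab) (snd ab)) \<and>
      (\<forall>ab\<in>Nset (J l) d. 0 \<le> lam l ab)" ..
  have "0 \<in> sos_set A k" for A
    unfolding sos_set_def by (rule CollectI, rule exI[of _ "[]"]) simp
  moreover have "F l \<in> polys_deg (I l) (dmax m f g k d)" if "l \<in> {1..p}" for l
    using subsetD[OF hcone_subset_polys_deg[of "J l" m g "I l" d f k] F[OF that]] J g that by blast
  moreover have "F l - (\<Sum>ab\<in>Nset (J l) d. mconst (lam l ab) * hab m g (fst ab) (snd ab)) = 0"
    if "l \<in> {1..p}" for l
    using bspec[OF lam that] by (metis diff_self)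
  ultimately have "\<forall>l\<in>{1..p}. F l \<in> polys_deg (I l) (dmax m f g k d) \<and>
      (\<forall>ab\<in>Nset (J l) d. 0 \<le> lam l ab) \<and>
      F l - (\<Sum>ab\<in>Nset (J l) d. mconst (lam l ab) * hab m g (fst ab) (snd ab)) \<in> sos_set (I l) k"
    using lam by simp
  then show ?thesis
    unfolding qkd_def using assms(1)
    by (intro Sup_upper CollectI exI[of _ t] conjI refl exI[of _ F] exI[of _ lam])
qed

section \<open>Monotonicity of the relaxation values and their upper bound\<close>

lemma dmax_mono: "d \<le> d' \<Longrightarrow> dmax m f g k d \<le> dmax m f g k d'"
  unfolding dmax_def by (intro max.mono order_refl mult_le_mono1)

lemma mono_qkd:
  assumes "\<And>l. l \<in> {1..p} \<Longrightarrow> finite (J l)"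
  shows "mono (qkd m p I J f g k)"
proof (rule monoI)
  fix d d' :: nat assume d: "d \<le> d'"
  show "qkd m p I J f g k d \<le> qkd m p I J f g k d'"
    unfolding qkd_def
  proof (rule Sup_subset_mono, safe)
    fix t F and lam :: "nat \<Rightarrow> (nat \<Rightarrow> nat) \<times> (nat \<Rightarrow> nat) \<Rightarrow> real"
    let ?h = "\<lambda>ab. hab m g (fst ab) (snd ab)"
    assume eq: "f - mconst t = (\<Sum>l\<in>{1..p}. F l)"
      and feas: "\<forall>l\<in>{1..p}. F l \<in> polys_deg (I l) (dmax m f g k d) \<and>
         (\<forall>ab\<in>Nset (J l) d. 0 \<le> lam l ab) \<and>
         F l - (\<Sum>ab\<in>Nset (J l) d. mconst (lam l ab) * ?h ab) \<in> sos_set (I l) k"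
    \<comment> \<open>Zero coefficients on the additional index pairs leave the polynomial
      unchanged.\<close>
    define lam' where "lam' l ab = (if ab \<in> Nset (J l) d then lam l ab else 0)" for l ab
    have lam': "(\<Sum>ab\<in>Nset (J l) d'. mconst (lam' l ab) * ?h ab) =
        (\<Sum>ab\<in>Nset (J l) d. mconst (lam l ab) * ?h ab)" if "l \<in> {1..p}" for l
      using Nset_mono[OF d] assms[OF that]
      by (intro sum.mono_neutral_cong_right finite_Nset) (auto simp: lam'_def)
    have "\<forall>l\<in>{1..p}. F l \<in> polys_deg (I l) (dmax m f g k d') \<and>
         (\<forall>ab\<in>Nset (J l) d'. 0 \<le> lam' l ab) \<and>
         F l - (\<Sum>ab\<in>Nset (J l) d'. mconst (lam' l ab) * ?h ab) \<in> sos_set (I l) k"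
    proof
      fix l assume l: "l \<in> {1..p}"
      note feas_l = bspec[OF feas l]
      have "F l \<in> polys_deg (I l) (dmax m f g k d')"
        using feas_l dmax_mono[OF d, of m f g k]
        unfolding polys_deg_def by (blast intro: order_trans)
      moreover have "\<forall>ab\<in>Nset (J l) d'. 0 \<le> lam' l ab"
        using feas_l by (simp add: lam'_def)
      ultimately show "F l \<in> polys_deg (I l) (dmax m f g k d') \<and>
         (\<forall>ab\<in>Nset (J l) d'. 0 \<le> lam' l ab) \<and>
         F l - (\<Sum>ab\<in>Nset (J l) d'. mconst (lam' l ab) * ?h ab) \<in> sos_set (I l) k"
        using feas_l unfolding lam'[OF l] by blast
    qed
    with eq show "\<exists>t'. ereal t = ereal t' \<and> (\<exists>F lam. f - mconst t' = (\<Sum>l\<in>{1..p}. F l) \<and>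
         (\<forall>l\<in>{1..p}. F l \<in> polys_deg (I l) (dmax m f g k d') \<and>
         (\<forall>ab\<in>Nset (J l) d'. 0 \<le> lam l ab) \<and>
         F l - (\<Sum>ab\<in>Nset (J l) d'. mconst (lam l ab) * ?h ab) \<in> sos_set (I l) k))"
      by blast
  qed
qed

text \<open>Products \<open>hab\<close> and squares are nonnegative at every point of
  \<open>Kset\<close>, hence so is \<open>f - mconst t\<close> for feasible \<open>t\<close>. If
  \<open>Kset\<close> is empty, the right-hand side is infinity.\<close>

lemma qkd_le_fstar: "qkd m p I J f g k d \<le> fstar n m f g"
  unfolding qkd_def fstar_def
proof (intro Sup_least Inf_greatest, safe)
  fix t x F and lam :: "nat \<Rightarrow> (nat \<Rightarrow> nat) \<times> (nat \<Rightarrow> nat) \<Rightarrow> real"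
  let ?h = "\<lambda>ab. hab m g (fst ab) (snd ab)"
  assume eq: "f - mconst t = (\<Sum>l\<in>{1..p}. F l)"
    and feas: "\<forall>l\<in>{1..p}. F l \<in> polys_deg (I l) (dmax m f g k d) \<and>
       (\<forall>ab\<in>Nset (J l) d. 0 \<le> lam l ab) \<and>
       F l - (\<Sum>ab\<in>Nset (J l) d. mconst (lam l ab) * ?h ab) \<in> sos_set (I l) k"
    and x: "x \<in> Kset n m g"
  have h: "0 \<le> mpeval (hab m g \<alpha> \<beta>) x" for \<alpha> \<beta>
    using x by (auto simp: hab_def mpeval_prod mpeval_mult mpeval_power mpeval_diff Kset_def
        intro!: prod_nonneg mult_nonneg_nonneg zero_le_power)
  have "0 \<le> mpeval (F l) x" if l: "l \<in> {1..p}" for l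
  proof -
    obtain qs where qs: "F l - (\<Sum>ab\<in>Nset (J l) d. mconst (lam l ab) * ?h ab) =
        sum_list (map (\<lambda>q. q * q) qs)"
      using feas l unfolding sos_set_def by blast
    have "mpeval (F l) x = mpeval (\<Sum>ab\<in>Nset (J l) d. mconst (lam l ab) * ?h ab) x +
        (\<Sum>q\<leftarrow>qs. mpeval q x * mpeval q x)"
      using arg_cong[OF qs, of "\<lambda>P. mpeval P x"]
      by (simp add: mpeval_diff mpeval_sum_list mpeval_mult o_def)
    also have "\<dots> \<ge> 0"
      using feas l h by (auto simp: mpeval_sum mpeval_mult intro!: add_nonneg_nonneg sum_nonneg sum_list_nonneg)
    finally show ?thesis .
  qed
  then have "0 \<le> mpeval (f - mconst t) x"
    unfolding eq mpeval_sum by (rule sum_nonneg)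
  then show "ereal t \<le> ereal (mpeval f x)"
    by (simp add: mpeval_diff)
qed

subsection \<open>Compactness tools\<close>

text \<open>Points are functions on all of \<open>nat\<close>; pinning the coordinates outside
  \<open>A\<close> to 0 makes the box compact and agrees with the convention of \<open>Kset\<close>
  and \<open>Kloc\<close>.\<close>

definition coord_box :: "nat set \<Rightarrow> real \<Rightarrow> real \<Rightarrow> (nat \<Rightarrow> real) set" where
  "coord_box A a b = {x. \<forall>i. (i \<in> A \<longrightarrow> a \<le> x i \<and> x i \<le> b) \<and> (i \<notin> A \<longrightarrow> x i = 0)}"

text \<open>By Tychonoff, as a product of intervals and singletons.\<close>

lemma compact_coord_box: "compact (coord_box A a b)"
proof -
  have "coord_box A a b = PiE UNIV (\<lambda>i. if i \<in> A then {a..b} else {0})"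
    by (auto simp: coord_box_def PiE_iff split: if_splits)
  moreover have "compactin (product_topology (\<lambda>_::nat. euclidean) UNIV)
      (PiE UNIV (\<lambda>i. if i \<in> A then {a..b::real} else {0}))"
    by (subst compactin_PiE) auto
  ultimately show ?thesis
    by (simp add: euclidean_product_topology)
qed

text \<open>On the compact set where \<open>h \<le> 0\<close> the penalty has a positive minimum, so
  a large multiple of it outweighs \<open>h\<close>; elsewhere a nonnegative multiple does no
  harm.\<close>

lemma positive_with_penalty:
  fixes h \<phi> :: "'a::t2_space \<Rightarrow> real"
  assumes S: "compact S" and h: "continuous_on S h" and \<phi>: "continuous_on S \<phi>"
    and nonneg: "\<And>x. x \<in> S \<Longrightarrow> 0 \<le> \<phi> x"
    and pos: "\<And>x. x \<in> S \<Longrightarrow> \<phi> x = 0 \<Longrightarrow> 0 < h x"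
  obtains c where "0 \<le> c" "\<And>x. x \<in> S \<Longrightarrow> 0 < h x + c * \<phi> x"
proof -
  define T where "T = S \<inter> h -` {..0}"
  have "closed T"
    unfolding T_def by (intro continuous_closed_preimage h compact_imp_closed[OF S] closed_atMost)
  then have T: "compact T"
    using compact_Int_closed[OF S, of T] by (simp add: T_def Int_absorb1 Int_assoc[symmetric])
  have hT: "continuous_on T h" and \<phi>T: "continuous_on T \<phi>"
    using h \<phi> by (auto simp: T_def intro: continuous_on_subset)
  show ?thesis
  proof (cases "T = {}")
    case True
    then show ?thesis
      using that[of 0] by (force simp: T_def)
  next
    case False
    obtain x0 where x0: "x0 \<in> T" "\<And>x. x \<in> T \<Longrightarrow> \<phi> x0 \<le> \<phi> x"
      using continuous_attains_inf[OF T False \<phi>T] by blast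
    obtain x1 where x1: "x1 \<in> T" "\<And>x. x \<in> T \<Longrightarrow> h x1 \<le> h x"
      using continuous_attains_inf[OF T False hT] by blast
    have \<phi>0: "0 < \<phi> x0"
      using x0(1) nonneg[of x0] pos[of x0] by (force simp: T_def)
    have h1: "h x1 \<le> 0"
      using x1(1) by (simp add: T_def)
    \<comment> \<open>With this \<open>c\<close>, the least penalty on \<open>T\<close> exceeds the
      worst deficit \<open>- h x1\<close> by exactly 1.\<close>
    define c where "c = (1 - h x1) / \<phi> x0"
    have c: "0 \<le> c" using \<phi>0 h1 by (simp add: c_def)
    have "0 < h x + c * \<phi> x" if x: "x \<in> S" for x
    proof (cases "x \<in> T")
      case True
      have "1 - h x1 = c * \<phi> x0" using \<phi>0 by (simp add: c_def)
      also have "\<dots> \<le> c * \<phi> x" using x0(2)[OF True] c by (rule mult_left_mono)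
      finally show ?thesis using x1(2)[OF True] by linarith
    next
      case False
      then have "0 < h x" using x by (auto simp: T_def)
      then show ?thesis using c nonneg[OF x] by (simp add: add_pos_nonneg)
    qed
    with c show ?thesis by (rule that)
  qed
qed

subsection \<open>Bernstein forms in the generators\<close>

text \<open>\<open>gen_rep g J Q q\<close> says that some polynomial \<open>P\<close> in variables \<open>y\<^sub>j\<close>, \<open>j \<in> J\<close>, satisfies
  \<open>Q = P(g)\<close> and has \<open>q\<close> as its polynomial function.\<close>
inductive gen_rep :: "(nat \<Rightarrow> mpoly) \<Rightarrow> nat set \<Rightarrow> mpoly \<Rightarrow> ((nat \<Rightarrow> real) \<Rightarrow> real) \<Rightarrow> bool"
  for g J where
  const: "gen_rep g J (mconst c) (\<lambda>_. c)"
| gen: "j \<in> J \<Longrightarrow> gen_rep g J (g j) (\<lambda>y. y j)"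
| add: "gen_rep g J P p \<Longrightarrow> gen_rep g J Q q \<Longrightarrow> gen_rep g J (P + Q) (\<lambda>y. p y + q y)"
| mult: "gen_rep g J P p \<Longrightarrow> gen_rep g J Q q \<Longrightarrow> gen_rep g J (P * Q) (\<lambda>y. p y * q y)"

lemma gen_rep_exists: "Q \<in> alg_gen (g ` J) \<Longrightarrow> \<exists>q. gen_rep g J Q q"
  by (induction rule: alg_gen.induct) (blast intro: gen_rep.intros)+

lemma gen_rep_continuous: "gen_rep g J Q q \<Longrightarrow> continuous_on S q"
proof (induction rule: gen_rep.induct)
  case (gen j)
  show ?case by (rule continuous_on_subset[OF continuous_on_product_coordinates]) simp
qed (auto intro: continuous_intros)

lemma gen_rep_diff:
  assumes "gen_rep g J P p" "gen_rep g J Q q"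
  shows "gen_rep g J (P - Q) (\<lambda>y. p y - q y)"
  using gen_rep.add[OF assms(1) gen_rep.mult[OF gen_rep.const[of _ _ "-1"] assms(2)]]
  by (simp add: mconst_uminus mconst_one)

lemma gen_rep_sum:
  "(\<And>a. a \<in> S \<Longrightarrow> gen_rep g J (P a) (p a)) \<Longrightarrow> gen_rep g J (sum P S) (\<lambda>y. \<Sum>a\<in>S. p a y)"
  using gen_rep.const[of g J 0]
  by (induction S rule: infinite_finite_induct) (auto intro: gen_rep.add)

text \<open>If each variable is the polynomial \<open>X i\<close> in the generators, then replacing
  the variables of \<open>p\<close> by the \<open>X i\<close> gives a polynomial in the generators
  that evaluates to \<open>p\<close> again.\<close>

lemma gen_rep_compose:
  assumes "p \<in> alg_gen (mvar ` A)" and X: "\<And>i. i \<in> A \<Longrightarrow> gen_rep g J (mvar i) (X i)"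
  shows "gen_rep g J p (\<lambda>y. mpeval p (\<lambda>i. if i \<in> A then X i y else 0))"
  using assms(1)
proof (induction rule: alg_gen.induct)
  case (gen p)
  then obtain i where "i \<in> A" "p = mvar i" by blast
  then show ?case using X[of i] by simp
qed (auto simp: mpeval_add mpeval_mult intro: gen_rep.intros)

text \<open>The multiplied-out form of \<open>gen_rep\<close>. The property
  \<open>bern_approx\<close> below passes easily to sums and scalar multiples, but not so easily to
  products, so these are reduced to monomials beforehand.\<close>

inductive lin_rep :: "(nat \<Rightarrow> mpoly) \<Rightarrow> nat set \<Rightarrow> mpoly \<Rightarrow> ((nat \<Rightarrow> real) \<Rightarrow> real) \<Rightarrow> bool"
  for g J where
  mon: "lin_rep g J (mconst c * (\<Prod>j\<in>J. g j ^ \<gamma> j)) (\<lambda>y. c * (\<Prod>j\<in>J. y j ^ \<gamma> j))"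
| add: "lin_rep g J P p \<Longrightarrow> lin_rep g J Q q \<Longrightarrow> lin_rep g J (P + Q) (\<lambda>y. p y + q y)"

lemma lin_rep_mult_mon:
  assumes "lin_rep g J Q q"
  shows "lin_rep g J ((mconst c * (\<Prod>j\<in>J. g j ^ \<gamma> j)) * Q) (\<lambda>y. (c * (\<Prod>j\<in>J. y j ^ \<gamma> j)) * q y)"
  using assms
proof (induction rule: lin_rep.induct)
  case (mon c' \<gamma>')
  show ?case
    using lin_rep.mon[of g J "c * c'" "\<lambda>j. \<gamma> j + \<gamma>' j"]
    by (simp add: power_add prod.distrib mconst_mult mult_ac)
next
  case (add P p Q q)
  then show ?case
    using lin_rep.add[OF add.IH] by (simp add: distrib_left)
qed

lemma lin_rep_mult:
  assumes "lin_rep g J P p" "lin_rep g J Q q"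
  shows "lin_rep g J (P * Q) (\<lambda>y. p y * q y)"
  using assms(1)
proof (induction rule: lin_rep.induct)
  case (mon c \<gamma>)
  show ?case using assms(2) by (rule lin_rep_mult_mon)
next
  case (add P p Q' q')
  then show ?case
    using lin_rep.add[OF add.IH] by (simp add: distrib_right)
qed

lemma gen_rep_imp_lin_rep:
  assumes "finite J" "gen_rep g J Q q"
  shows "lin_rep g J Q q"
  using assms(2)
proof (induction rule: gen_rep.induct)
  case (const c)
  show ?case using lin_rep.mon[of g J c "\<lambda>_. 0"] by simp
next
  case (gen j)
  have eq: "(\<Prod>i\<in>J. u i ^ (if i = j then 1 else 0)) = u j" for u :: "nat \<Rightarrow> 'a::comm_monoid_mult"
  proof -
    have "(\<Prod>i\<in>J. u i ^ (if i = j then 1 else 0)) = (\<Prod>i\<in>J. if i = j then u i else 1)"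
      by (rule prod.cong) auto
    then show ?thesis using gen assms(1) by simp
  qed
  show ?case
    using lin_rep.mon[of g J 1 "\<lambda>i. if i = j then 1 else 0"] unfolding eq by (simp add: mconst_one)
qed (auto intro: lin_rep.add lin_rep_mult)

text \<open>The tensor-product Bernstein form of degree \<open>N\<close> in each variable, evaluated
  at the \<open>g j\<close>. Up to positive constants its basis elements are products
  \<open>hab\<close>.\<close>

definition bern :: "(nat \<Rightarrow> mpoly) \<Rightarrow> nat set \<Rightarrow> nat \<Rightarrow> ((nat \<Rightarrow> nat) \<Rightarrow> real) \<Rightarrow> mpoly" where
  "bern g J N b = (\<Sum>a\<in>PiE J (\<lambda>_. {..N}). mconst (b a) *
     (\<Prod>j\<in>J. mconst (real (N choose a j)) * (g j ^ a j * (1 - g j) ^ (N - a j))))"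

text \<open>The Bernstein coefficients converge uniformly to the values of \<open>q\<close> on the
  grid. They are existentially quantified because relations among the \<open>g j\<close> can make
  the expansion of \<open>Q\<close> ambiguous; padding by 0 off \<open>J\<close> puts the grid
  points into \<open>coord_box J 0 1\<close>.\<close>

definition bern_approx :: "(nat \<Rightarrow> mpoly) \<Rightarrow> nat set \<Rightarrow> mpoly \<Rightarrow> ((nat \<Rightarrow> real) \<Rightarrow> real) \<Rightarrow> bool" where
  "bern_approx g J Q q \<longleftrightarrow> (\<forall>\<epsilon>>0. \<forall>\<^sub>F N in sequentially. \<exists>b. Q = bern g J N b \<and>
     (\<forall>a\<in>PiE J (\<lambda>_. {..N}). \<bar>b a - q (\<lambda>j. if j \<in> J then real (a j) / real N else 0)\<bar> \<le> \<epsilon>))"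

lemma bern_add: "bern g J N b + bern g J N b' = bern g J N (\<lambda>a. b a + b' a)"
  by (simp add: bern_def sum.distrib mconst_add distrib_right)

lemma bern_scale: "mconst c * bern g J N b = bern g J N (\<lambda>a. c * b a)"
  by (simp add: bern_def sum_distrib_left mconst_mult mult.assoc)

lemma bern_approx_add:
  assumes "bern_approx g J P p" "bern_approx g J Q q"
  shows "bern_approx g J (P + Q) (\<lambda>y. p y + q y)"
  unfolding bern_approx_def
proof (intro allI impI)
  fix \<epsilon> :: real assume "0 < \<epsilon>"
  then have "0 < \<epsilon> / 2" by simp
  with assms have "\<forall>\<^sub>F N in sequentially. \<exists>b. P = bern g J N b \<and>
     (\<forall>a\<in>PiE J (\<lambda>_. {..N}). \<bar>b a - p (\<lambda>j. if j \<in> J then real (a j) / real N else 0)\<bar> \<le> \<epsilon> / 2)"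
    "\<forall>\<^sub>F N in sequentially. \<exists>b. Q = bern g J N b \<and>
     (\<forall>a\<in>PiE J (\<lambda>_. {..N}). \<bar>b a - q (\<lambda>j. if j \<in> J then real (a j) / real N else 0)\<bar> \<le> \<epsilon> / 2)"
    unfolding bern_approx_def by blast+
  then show "\<forall>\<^sub>F N in sequentially. \<exists>b. P + Q = bern g J N b \<and>
     (\<forall>a\<in>PiE J (\<lambda>_. {..N}). \<bar>b a - (p (\<lambda>j. if j \<in> J then real (a j) / real N else 0) +
        q (\<lambda>j. if j \<in> J then real (a j) / real N else 0))\<bar> \<le> \<epsilon>)"
  proof eventually_elim
    case (elim N)
    then obtain b b' where b: "P = bern g J N b" "Q = bern g J N b'"
      "\<forall>a\<in>PiE J (\<lambda>_. {..N}). \<bar>b a - p (\<lambda>j. if j \<in> J then real (a j) / real N else 0)\<bar> \<le> \<epsilon> / 2"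
      "\<forall>a\<in>PiE J (\<lambda>_. {..N}). \<bar>b' a - q (\<lambda>j. if j \<in> J then real (a j) / real N else 0)\<bar> \<le> \<epsilon> / 2"
      by blast
    show ?case
    proof (intro exI conjI ballI)
      show "P + Q = bern g J N (\<lambda>a. b a + b' a)" by (simp add: b bern_add)
      fix a assume a: "a \<in> PiE J (\<lambda>_. {..N})"
      show "\<bar>b a + b' a - (p (\<lambda>j. if j \<in> J then real (a j) / real N else 0) +
        q (\<lambda>j. if j \<in> J then real (a j) / real N else 0))\<bar> \<le> \<epsilon>"
        using bspec[OF b(3) a] bspec[OF b(4) a] by linarith
    qed
  qed
qed

lemma bern_approx_scale:
  assumes "bern_approx g J Q q"
  shows "bern_approx g J (mconst c * Q) (\<lambda>y. c * q y)"
  unfolding bern_approx_def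
proof (intro allI impI)
  fix \<epsilon> :: real assume \<epsilon>: "0 < \<epsilon>"
  \<comment> \<open>The summand 1 avoids a division by zero when \<open>c = 0\<close>.\<close>
  define \<delta> where "\<delta> = \<epsilon> / (\<bar>c\<bar> + 1)"
  have \<delta>: "0 < \<delta>" "\<bar>c\<bar> * \<delta> \<le> \<epsilon>"
    using \<epsilon> by (auto simp: \<delta>_def field_simps)
  with assms have "\<forall>\<^sub>F N in sequentially. \<exists>b. Q = bern g J N b \<and>
     (\<forall>a\<in>PiE J (\<lambda>_. {..N}). \<bar>b a - q (\<lambda>j. if j \<in> J then real (a j) / real N else 0)\<bar> \<le> \<delta>)"
    unfolding bern_approx_def by blast
  then show "\<forall>\<^sub>F N in sequentially. \<exists>b. mconst c * Q = bern g J N b \<and>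
     (\<forall>a\<in>PiE J (\<lambda>_. {..N}). \<bar>b a - c * q (\<lambda>j. if j \<in> J then real (a j) / real N else 0)\<bar> \<le> \<epsilon>)"
  proof eventually_elim
    case (elim N)
    then obtain b where b: "Q = bern g J N b"
      "\<forall>a\<in>PiE J (\<lambda>_. {..N}). \<bar>b a - q (\<lambda>j. if j \<in> J then real (a j) / real N else 0)\<bar> \<le> \<delta>"
      by blast
    show ?case
    proof (intro exI conjI ballI)
      show "mconst c * Q = bern g J N (\<lambda>a. c * b a)" by (simp add: b bern_scale)
      fix a assume a: "a \<in> PiE J (\<lambda>_. {..N})"
      have "\<bar>c * b a - c * q (\<lambda>j. if j \<in> J then real (a j) / real N else 0)\<bar> =
          \<bar>c\<bar> * \<bar>b a - q (\<lambda>j. if j \<in> J then real (a j) / real N else 0)\<bar>"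
        by (simp flip: abs_mult right_diff_distrib)
      also have "\<dots> \<le> \<bar>c\<bar> * \<delta>"
        using bspec[OF b(2) a] by (intro mult_left_mono) auto
      finally show "\<bar>c * b a - c * q (\<lambda>j. if j \<in> J then real (a j) / real N else 0)\<bar> \<le> \<epsilon>"
        using \<delta>(2) by linarith
    qed
  qed
qed

text \<open>For \<open>c \<le> N\<close> this is \<open>(a choose c) / (N choose c)\<close>, the
  Bernstein coefficient of a \<open>c\<close>-th power in degree \<open>N\<close>. Written as a
  product it vanishes for \<open>a < c\<close> and can be compared with \<open>(a / N) ^ c\<close>
  factor by factor.\<close>

definition falling_ratio :: "nat \<Rightarrow> nat \<Rightarrow> nat \<Rightarrow> real" where
  "falling_ratio N c a = (\<Prod>i<c. (real a - real i) / (real N - real i))"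

text \<open>The identity \<open>(a choose c) * (N choose a) = (N choose c) * ((N - c) choose (a -
  c))\<close>, divided by \<open>N choose c\<close>.\<close>

lemma falling_ratio_times_binomial:
  assumes "c \<le> N" "a \<le> N"
  shows "falling_ratio N c a * real (N choose a) = (if a < c then 0 else real ((N - c) choose (a - c)))"
  using assms(1)
proof (induction c)
  case 0
  then show ?case by (simp add: falling_ratio_def)
next
  case (Suc c)
  have IH: "falling_ratio N c a * real (N choose a) = (if a < c then 0 else real ((N - c) choose (a - c)))"
    using Suc by simp
  have step: "falling_ratio N (Suc c) a * real (N choose a) =
      (falling_ratio N c a * real (N choose a)) * ((real a - real c) / (real N - real c))"
    by (simp add: falling_ratio_def)
  consider "a < c" | "a = c" | "c < a" by linarith
  then show ?case
  proof cases
    case 3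
    have "(a - c) * ((N - c) choose (a - c)) = (N - c) * ((N - c - 1) choose (a - c - 1))"
      using 3 by (intro times_binomial_minus1_eq) simp
    then have "real (a - c) * real ((N - c) choose (a - c)) =
        real (N - c) * real ((N - Suc c) choose (a - Suc c))"
      by (simp flip: of_nat_mult)
    then have "(real a - real c) * real ((N - c) choose (a - c)) =
        (real N - real c) * real ((N - Suc c) choose (a - Suc c))"
      using 3 Suc.prems by (simp add: of_nat_diff)
    then show ?thesis
      unfolding step IH using 3 Suc.prems by (simp add: field_simps)
  next
    case 2
    then show ?thesis unfolding step IH by simp
  qed (simp_all add: step IH)
qed

text \<open>Degree elevation: multiply \<open>u ^ c\<close> by
  \<open>(u + (1 - u)) ^ (N - c)\<close>, which is 1, and expand by the binomial theorem.\<close>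

lemma power_eq_bernstein_sum:
  fixes u :: mpoly
  assumes "c \<le> N"
  shows "u ^ c = (\<Sum>a\<le>N. mconst (falling_ratio N c a) *
    (mconst (real (N choose a)) * (u ^ a * (1 - u) ^ (N - a))))"
proof -
  have "(\<Sum>a\<le>N. mconst (falling_ratio N c a) * (mconst (real (N choose a)) * (u ^ a * (1 - u) ^ (N - a)))) =
      (\<Sum>a\<le>N. mconst (if a < c then 0 else real ((N - c) choose (a - c))) * (u ^ a * (1 - u) ^ (N - a)))"
    using assms by (intro sum.cong refl)
      (simp only: falling_ratio_times_binomial atMost_iff flip: mult.assoc mconst_mult)
  also have "\<dots> = (\<Sum>a\<in>{c..N}. of_nat ((N - c) choose (a - c)) * (u ^ a * (1 - u) ^ (N - a)))"
    by (intro sum.mono_neutral_cong_right) (auto simp: mconst_of_nat)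
  also have "\<dots> = (\<Sum>i\<le>N - c. of_nat ((N - c) choose i) * (u ^ (i + c) * (1 - u) ^ (N - c - i)))"
    using assms by (intro sum.reindex_bij_witness[of _ "\<lambda>i. i + c" "\<lambda>a. a - c"]) auto
  also have "\<dots> = u ^ c * (u + (1 - u)) ^ (N - c)"
    by (subst binomial_ring) (simp add: sum_distrib_left power_add algebra_simps)
  finally show ?thesis by simp
qed

text \<open>Each of the \<open>c\<close> factors differs from \<open>a / N\<close> by at most
  \<open>c / (N - c)\<close>, and for numbers of modulus at most 1 the difference of two products is
  bounded by the sum of the differences of the factors.\<close>

lemma falling_ratio_approx:
  assumes "2 * c < N" "a \<le> N"
  shows "\<bar>falling_ratio N c a\<bar> \<le> 1"
    and "\<bar>falling_ratio N c a - (real a / real N) ^ c\<bar> \<le> real c * (real c / (real N - real c))"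
proof -
  \<comment> \<open>The numerator is negative when \<open>a < i\<close>; then
    \<open>2 * c < N\<close> gives \<open>i - a \<le> N - i\<close>.\<close>
  have bd: "\<bar>(real a - real i) / (real N - real i)\<bar> \<le> 1" if "i < c" for i
    using that assms by (auto simp: abs_le_iff field_simps)
  have bd': "\<bar>real a / real N\<bar> \<le> 1"
    using assms by (auto simp: field_simps)
  show "\<bar>falling_ratio N c a\<bar> \<le> 1"
    unfolding falling_ratio_def abs_prod using bd by (intro prod_le_1) auto
  have "norm ((\<Prod>i<c. (real a - real i) / (real N - real i)) - (\<Prod>i<c. real a / real N)) \<le>
      (\<Sum>i<c. norm ((real a - real i) / (real N - real i) - real a / real N))"
    using bd bd' by (intro norm_prod_diff) auto
  also have "\<dots> \<le> (\<Sum>i<c. real c / (real N - real c))"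
  proof (rule sum_mono)
    fix i assume "i \<in> {..<c}"
    then have i: "i < c" by simp
    have N: "real N > 0" "real N - real i > 0" "real N - real c > 0"
      using assms i by auto
    have "(real a - real i) / (real N - real i) - real a / real N =
        - (real i / (real N - real i) * ((real N - real a) / real N))"
      using N by (simp add: divide_simps) (simp add: algebra_simps)
    then have "norm ((real a - real i) / (real N - real i) - real a / real N) =
        real i / (real N - real i) * ((real N - real a) / real N)"
      using N assms by (simp add: abs_mult)
    also have "\<dots> \<le> real i / (real N - real i) * 1"
      using N assms by (intro mult_left_mono) auto
    also have "\<dots> \<le> real c / (real N - real c)"
      using N i by (simp, intro frac_le) auto
    finally show "norm ((real a - real i) / (real N - real i) - real a / real N) \<le>
        real c / (real N - real c)" .
  qed
  finally show "\<bar>falling_ratio N c a - (real a / real N) ^ c\<bar> \<le> real c * (real c / (real N - real c))"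
    by (simp add: falling_ratio_def)
qed

text \<open>Multiplying the one-variable expansions multiplies their coefficients; as all of these
  have modulus at most 1, the errors merely add up over \<open>J\<close>.\<close>

lemma bern_approx_mon:
  assumes J: "finite J"
  shows "bern_approx g J (\<Prod>j\<in>J. g j ^ \<gamma> j) (\<lambda>y. \<Prod>j\<in>J. y j ^ \<gamma> j)"
  unfolding bern_approx_def
proof (intro allI impI)
  fix \<epsilon> :: real assume \<epsilon>: "0 < \<epsilon>"
  have "(\<lambda>N. real c * (real c / (real N - real c))) \<longlonglongrightarrow> 0" for c :: nat
    by real_asymp
  then have "(\<lambda>N. \<Sum>j\<in>J. real (\<gamma> j) * (real (\<gamma> j) / (real N - real (\<gamma> j)))) \<longlonglongrightarrow> (\<Sum>j\<in>J. 0)"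
    by (intro tendsto_sum)
  then have "\<forall>\<^sub>F N in sequentially. (\<Sum>j\<in>J. real (\<gamma> j) * (real (\<gamma> j) / (real N - real (\<gamma> j)))) < \<epsilon>"
    using \<epsilon> by (intro order_tendstoD) auto
  moreover have "\<forall>\<^sub>F N in sequentially. \<forall>j\<in>J. 2 * \<gamma> j < N"
    using J by (intro eventually_ball_finite ballI eventually_gt_at_top)
  ultimately show "\<forall>\<^sub>F N in sequentially. \<exists>b. (\<Prod>j\<in>J. g j ^ \<gamma> j) = bern g J N b \<and>
     (\<forall>a\<in>PiE J (\<lambda>_. {..N}). \<bar>b a - (\<Prod>j\<in>J. (if j \<in> J then real (a j) / real N else 0) ^ \<gamma> j)\<bar> \<le> \<epsilon>)"
  proof eventually_elim
    case (elim N)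
    show ?case
    proof (intro exI conjI ballI)
      have "(\<Prod>j\<in>J. g j ^ \<gamma> j) = (\<Prod>j\<in>J. \<Sum>a\<le>N. mconst (falling_ratio N (\<gamma> j) a) *
          (mconst (real (N choose a)) * (g j ^ a * (1 - g j) ^ (N - a))))"
        using elim(2) by (intro prod.cong refl power_eq_bernstein_sum) auto
      also have "\<dots> = bern g J N (\<lambda>a. \<Prod>j\<in>J. falling_ratio N (\<gamma> j) (a j))"
        using J by (simp add: bern_def prod_sum_PiE prod.distrib mconst_prod)
      finally show "(\<Prod>j\<in>J. g j ^ \<gamma> j) = bern g J N (\<lambda>a. \<Prod>j\<in>J. falling_ratio N (\<gamma> j) (a j))" .
      fix a assume a: "a \<in> PiE J (\<lambda>_. {..N})"
      have N: "2 * \<gamma> j < N \<and> a j \<le> N" if "j \<in> J" for j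
        using that elim(2) a by (auto simp: PiE_iff)
      have "norm ((\<Prod>j\<in>J. falling_ratio N (\<gamma> j) (a j)) - (\<Prod>j\<in>J. (real (a j) / real N) ^ \<gamma> j)) \<le>
          (\<Sum>j\<in>J. norm (falling_ratio N (\<gamma> j) (a j) - (real (a j) / real N) ^ \<gamma> j))"
      proof (rule norm_prod_diff)
        fix j assume "j \<in> J"
        with N show "norm (falling_ratio N (\<gamma> j) (a j)) \<le> 1"
          by (simp add: falling_ratio_approx(1))
        from N[OF \<open>j \<in> J\<close>] show "norm ((real (a j) / real N) ^ \<gamma> j) \<le> 1"
          by (auto simp: norm_power intro!: power_le_one)
      qed
      also have "\<dots> \<le> (\<Sum>j\<in>J. real (\<gamma> j) * (real (\<gamma> j) / (real N - real (\<gamma> j))))"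
        using N by (intro sum_mono) (auto simp only: real_norm_def falling_ratio_approx(2))
      also have "\<dots> \<le> \<epsilon>" using elim(1) by simp
      finally show "\<bar>(\<Prod>j\<in>J. falling_ratio N (\<gamma> j) (a j)) -
          (\<Prod>j\<in>J. (if j \<in> J then real (a j) / real N else 0) ^ \<gamma> j)\<bar> \<le> \<epsilon>"
        by simp
    qed
  qed
qed

lemma gen_rep_imp_bern_approx:
  assumes "finite J" "gen_rep g J Q q"
  shows "bern_approx g J Q q"
  using gen_rep_imp_lin_rep[OF assms]
  by (induction rule: lin_rep.induct)
     (auto intro: bern_approx_add bern_approx_scale bern_approx_mon[OF assms(1)])

text \<open>In every basis element each \<open>j\<close> contributes the exponents
  \<open>a j\<close> and \<open>N - a j\<close>, hence the level \<open>card J * N\<close>; the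
  binomial factors are absorbed into the coefficient.\<close>

lemma bern_in_hcone:
  assumes J: "finite J" "J \<subseteq> {1..m}" and b: "\<And>a. a \<in> PiE J (\<lambda>_. {..N}) \<Longrightarrow> 0 \<le> b a"
  shows "bern g J N b \<in> hcone m g J (card J * N)"
  unfolding bern_def
proof (rule hcone_sum)
  fix a assume a: "a \<in> PiE J (\<lambda>_. {..N})"
  define \<alpha> \<beta> where "\<alpha> j = (if j \<in> J then a j else 0)" and "\<beta> j = (if j \<in> J then N - a j else 0)" for j
  have "(\<Sum>j\<in>J. \<alpha> j + \<beta> j) = (\<Sum>j\<in>J. N)"
    using a by (intro sum.cong) (auto simp: \<alpha>_def \<beta>_def PiE_iff)
  then have N: "(\<alpha>, \<beta>) \<in> Nset J (card J * N)"
    by (simp add: Nset_def \<alpha>_def \<beta>_def)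
  have "hab m g \<alpha> \<beta> = (\<Prod>j\<in>J. g j ^ \<alpha> j * (1 - g j) ^ \<beta> j)"
    unfolding hab_def using J by (intro prod.mono_neutral_right) (auto simp: \<alpha>_def \<beta>_def)
  also have "\<dots> = (\<Prod>j\<in>J. g j ^ a j * (1 - g j) ^ (N - a j))"
    by (intro prod.cong) (auto simp: \<alpha>_def \<beta>_def)
  finally have "mconst (b a) * (\<Prod>j\<in>J. mconst (real (N choose a j)) * (g j ^ a j * (1 - g j) ^ (N - a j))) =
      mconst (b a * (\<Prod>j\<in>J. real (N choose a j))) * hab m g \<alpha> \<beta>"
    by (simp add: prod.distrib mconst_mult mconst_prod mult.assoc)
  also have "\<dots> \<in> hcone m g J (card J * N)"
    using J N b[OF a] by (intro hcone_single mult_nonneg_nonneg prod_nonneg) auto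
  finally show "mconst (b a) * (\<Prod>j\<in>J. mconst (real (N choose a j)) * (g j ^ a j * (1 - g j) ^ (N - a j)))
      \<in> hcone m g J (card J * N)" .
qed

lemma positive_on_unit_box_in_hcone:
  assumes J: "finite J" "J \<subseteq> {1..m}" and Q: "gen_rep g J Q q"
    and pos: "\<And>y. y \<in> coord_box J 0 1 \<Longrightarrow> 0 < q y"
  shows "\<exists>d. Q \<in> hcone m g J d"
proof -
  have "coord_box J 0 1 \<noteq> {}"
    by (auto simp: coord_box_def intro: exI[of _ "\<lambda>_. 0"])
  then obtain y0 where y0: "y0 \<in> coord_box J 0 1" "\<And>y. y \<in> coord_box J 0 1 \<Longrightarrow> q y0 \<le> q y"
    using continuous_attains_inf[OF compact_coord_box _ gen_rep_continuous[OF Q]] by blast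
  \<comment> \<open>The tolerance is the minimum of \<open>q\<close> on the box: each coefficient is
    at least a value of \<open>q\<close> on the grid minus that minimum.\<close>
  have "\<forall>\<^sub>F N in sequentially. \<exists>b. Q = bern g J N b \<and>
     (\<forall>a\<in>PiE J (\<lambda>_. {..N}). \<bar>b a - q (\<lambda>j. if j \<in> J then real (a j) / real N else 0)\<bar> \<le> q y0)"
    using gen_rep_imp_bern_approx[OF J(1) Q] pos[OF y0(1)] unfolding bern_approx_def by blast
  then obtain N b where b: "Q = bern g J N b"
     "\<forall>a\<in>PiE J (\<lambda>_. {..N}). \<bar>b a - q (\<lambda>j. if j \<in> J then real (a j) / real N else 0)\<bar> \<le> q y0"
    by (auto simp: eventually_sequentially)
  have "0 \<le> b a" if a: "a \<in> PiE J (\<lambda>_. {..N})" for a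
  proof -
    have "(\<lambda>j. if j \<in> J then real (a j) / real N else 0) \<in> coord_box J 0 1"
      using a by (auto simp: coord_box_def PiE_iff divide_le_eq_1)
    then show ?thesis using y0(2) bspec[OF b(2) a] by fastforce
  qed
  then show ?thesis
    unfolding b(1) using bern_in_hcone[OF J] by blast
qed

text \<open>Since the \<open>g\<^sub>j\<close> generate the polynomial ring, the image of \<open>Kloc\<close> under \<open>g\<close> is the part of the unit box where
  \<open>y\<^sub>j = g\<^sub>j(X(y))\<close>, with \<open>X\<close> expressing the variables through the generators. As polynomials in
  the generators these relations vanish, so adding a large multiple of their squares changes only
  the function on the box, making it positive there.\<close>
theorem krivine_representation:
  assumes J: "finite J" "J \<subseteq> {1..m}" and g: "\<And>j. j \<in> J \<Longrightarrow> g j \<in> polys_in A"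
    and gen: "polys_in A \<subseteq> alg_gen (g ` J)" and p: "p \<in> polys_in A"
    and pos: "\<And>x. x \<in> Kloc A J g \<Longrightarrow> 0 < mpeval p x"
  shows "\<exists>d. p \<in> hcone m g J d"
proof -
  have "\<forall>i\<in>A. \<exists>q. gen_rep g J (mvar i) q"
    using gen polys_in_mvar gen_rep_exists by blast
  from bchoice[OF this] obtain X where X: "\<And>i. i \<in> A \<Longrightarrow> gen_rep g J (mvar i) (X i)"
    by blast
  define x where "x y i = (if i \<in> A then X i y else 0)" for y i
  have rep: "gen_rep g J r (\<lambda>y. mpeval r (x y))" if "r \<in> polys_in A" for r
    unfolding x_def using that polys_in_subset_alg_gen_mvar by (intro gen_rep_compose X) auto
  define \<phi> where "\<phi> y = (\<Sum>j\<in>J. (y j - mpeval (g j) (x y)) * (y j - mpeval (g j) (x y)))" for y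
  \<comment> \<open>Here \<open>g j\<close> is represented once by the coordinate \<open>y j\<close>
    and once through \<open>X\<close>. The zero polynomial thereby gets a function that may be
    nonzero on the box.\<close>
  have R: "gen_rep g J (\<Sum>j\<in>J. (g j - g j) * (g j - g j)) \<phi>"
    unfolding \<phi>_def
    by (intro gen_rep_sum gen_rep.mult gen_rep_diff gen_rep.gen rep g)
  have \<phi>0: "0 \<le> \<phi> y" for y
    unfolding \<phi>_def by (intro sum_nonneg) auto
  have P0: "0 < mpeval p (x y)" if y: "y \<in> coord_box J 0 1" and zero: "\<phi> y = 0" for y
  proof (rule pos)
    have "\<forall>j\<in>J. (y j - mpeval (g j) (x y)) * (y j - mpeval (g j) (x y)) = 0"
      using zero J(1) unfolding \<phi>_def by (subst (asm) sum_nonneg_eq_0_iff) auto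
    then have "\<forall>j\<in>J. mpeval (g j) (x y) = y j" by simp
    then show "x y \<in> Kloc A J g"
      using y by (auto simp: Kloc_def coord_box_def x_def)
  qed
  obtain c where c: "\<And>y. y \<in> coord_box J 0 1 \<Longrightarrow> 0 < mpeval p (x y) + c * \<phi> y"
    using positive_with_penalty[OF compact_coord_box[of J 0 1]
        gen_rep_continuous[OF rep[OF p]] gen_rep_continuous[OF R] \<phi>0 P0] by blast
  have "gen_rep g J p (\<lambda>y. mpeval p (x y) + c * \<phi> y)"
    using gen_rep.add[OF rep[OF p] gen_rep.mult[OF gen_rep.const[of _ _ c] R]] by simp
  then show ?thesis
    using c by (rule positive_on_unit_box_in_hcone[OF J])
qed

subsection \<open>Splitting a positive sum along the running intersection property\<close>

text \<open>Fix the coordinates in \<open>D\<close> and let the others run through the box: the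
  infimum of \<open>F\<close> depends continuously on the fixed ones, and Stone-Weierstrass puts
  \<open>q\<close> just below it. The last property says that some point of the fibre nearly attains
  the bound \<open>q\<close>.\<close>

lemma polynomial_below_fibre_min:
  assumes D: "D \<subseteq> A" and F: "continuous_on (coord_box A a b) F" and ab: "a \<le> 0" "0 \<le> b" and \<epsilon>: "0 < \<epsilon>"
  obtains q where "q \<in> polys_in D" "\<And>x. x \<in> coord_box A a b \<Longrightarrow> mpeval q x < F x"
    "\<And>x. x \<in> coord_box A a b \<Longrightarrow>
       \<exists>z\<in>coord_box A a b. F (\<lambda>i. if i \<in> D then x i else z i) < mpeval q x + \<epsilon>"
proof -
  let ?B = "coord_box A a b" and ?S = "coord_box D a b"
  define merge :: "(nat \<Rightarrow> real) \<Rightarrow> (nat \<Rightarrow> real) \<Rightarrow> nat \<Rightarrow> real" where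
    "merge x z i = (if i \<in> D then x i else z i)" for x z i
  define \<mu> where "\<mu> x = (INF z\<in>?B. F (merge x z))" for x
  have B: "compact ?B" and S: "compact ?S" by (rule compact_coord_box)+
  have "(\<lambda>_. 0) \<in> ?B" using ab by (simp add: coord_box_def)
  then have B_ne: "?B \<noteq> {}" by blast
  have merge_B: "merge x z \<in> ?B" if "x \<in> ?S \<union> ?B" "z \<in> ?B" for x z
    using that D by (auto simp: coord_box_def merge_def)
  have "continuous_on UNIV (\<lambda>u. (if i \<in> D then fst u i else snd u i) :: real)" for i
  proof -
    have "continuous_on UNIV (\<lambda>u::(nat \<Rightarrow> real) \<times> (nat \<Rightarrow> real). fst u i)"
      "continuous_on UNIV (\<lambda>u::(nat \<Rightarrow> real) \<times> (nat \<Rightarrow> real). snd u i)"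
      by (rule continuous_on_compose2[OF continuous_on_product_coordinates], intro continuous_intros, simp)+
    then show ?thesis by (cases "i \<in> D") simp_all
  qed
  then have merge_cont: "continuous_on UNIV (\<lambda>u. merge (fst u) (snd u))"
    unfolding merge_def by (rule continuous_on_coordinatewise_then_product)
  have "continuous_on (?S \<times> ?B) (\<lambda>u. F (merge (fst u) (snd u)))"
    by (rule continuous_on_compose2[OF F continuous_on_subset[OF merge_cont]])
       (auto intro: merge_B)
  \<comment> \<open>Moving \<open>x\<close> slightly changes \<open>F\<close> little for all
    \<open>z\<close> at once, and therefore changes the infimum little.\<close>
  then have unif: "uniformly_continuous_on (?S \<times> ?B) (\<lambda>u. F (merge (fst u) (snd u)))"
    using B S by (intro compact_uniformly_continuous compact_Times)
  have bdd: "bdd_below ((\<lambda>z. F (merge x z)) ` ?B)" if "x \<in> ?S \<union> ?B" for x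
  proof -
    obtain w where "\<And>y. y \<in> ?B \<Longrightarrow> F w \<le> F y"
      using continuous_attains_inf[OF B B_ne F] by blast
    then show ?thesis
      using merge_B[OF that] by (intro bdd_belowI2[of _ "F w"]) auto
  qed
  have \<mu>_cont: "continuous_on ?S \<mu>"
    unfolding continuous_on_iff
  proof (intro ballI allI impI)
    fix x and e :: real assume x: "x \<in> ?S" and e: "0 < e"
    then obtain d where d: "0 < d" "\<And>u v. u \<in> ?S \<times> ?B \<Longrightarrow> v \<in> ?S \<times> ?B \<Longrightarrow> dist v u < d \<Longrightarrow>
        dist (F (merge (fst v) (snd v))) (F (merge (fst u) (snd u))) < e / 2"
      using unif unfolding uniformly_continuous_on_def by (metis half_gt_zero)
    have le: "\<mu> u \<le> \<mu> v + e / 2" if "u \<in> ?S" "v \<in> ?S" "dist u v < d" for u v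
    proof -
      have "\<mu> u - e / 2 \<le> \<mu> v"
        unfolding \<mu>_def[of v]
      proof (rule cINF_greatest[OF B_ne])
        fix z assume z: "z \<in> ?B"
        have close: "dist (F (merge u z)) (F (merge v z)) < e / 2"
          using d(2)[of "(v, z)" "(u, z)"] that z by (simp add: dist_Pair_Pair)
        have "\<mu> u \<le> F (merge u z)"
          unfolding \<mu>_def using bdd[of u] that z by (intro cINF_lower) auto
        also have "\<dots> \<le> F (merge v z) + e / 2"
          using close unfolding dist_real_def by linarith
        finally show "\<mu> u - e / 2 \<le> F (merge v z)" by simp
      qed
      then show ?thesis by simp
    qed
    show "\<exists>d>0. \<forall>y\<in>?S. dist y x < d \<longrightarrow> dist (\<mu> y) (\<mu> x) < e"
    proof (intro exI conjI ballI impI)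
      show "0 < d" by fact
      fix y assume "y \<in> ?S" "dist y x < d"
      then show "dist (\<mu> y) (\<mu> x) < e"
        using le[of x y] le[of y x] x e by (auto simp: dist_real_def dist_commute abs_less_iff)
    qed
  qed
  interpret function_ring_on "mpeval ` polys_in D" ?S
  proof
    show "compact ?S" by fact
    show "continuous_on ?S f" if "f \<in> mpeval ` polys_in D" for f
      using that by (auto intro: continuous_on_mpeval)
    show "(\<lambda>x. f x + g x) \<in> mpeval ` polys_in D"
      if "f \<in> mpeval ` polys_in D" "g \<in> mpeval ` polys_in D" for f g
      using that by (auto simp: mpeval_add intro!: image_eqI[OF _ polys_in_add])
    show "(\<lambda>x. f x * g x) \<in> mpeval ` polys_in D"
      if "f \<in> mpeval ` polys_in D" "g \<in> mpeval ` polys_in D" for f g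
      using that by (auto simp: mpeval_mult intro!: image_eqI[OF _ polys_in_mult])
    show "(\<lambda>_. c) \<in> mpeval ` polys_in D" for c
      by (rule image_eqI[of _ _ "mconst c"]) auto
    show "\<exists>f\<in>mpeval ` polys_in D. f x \<noteq> f y" if "x \<in> ?S" "y \<in> ?S" "x \<noteq> y" for x y
    proof -
      from \<open>x \<noteq> y\<close> obtain i where i: "x i \<noteq> y i" by blast
      then have "i \<in> D" using that by (force simp: coord_box_def)
      then show ?thesis
        using i by (intro bexI[OF _ imageI[OF polys_in_mvar]]) auto
    qed
  qed
  \<comment> \<open>An approximation of the lowered function with error below
    \<open>\<epsilon> / 2\<close> lies strictly between \<open>\<mu> - \<epsilon>\<close> and
    \<open>\<mu>\<close>.\<close>
  have "continuous_on ?S (\<lambda>x. \<mu> x - \<epsilon> / 2)"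
    by (intro continuous_on_diff \<mu>_cont continuous_on_const)
  then have "\<exists>f\<in>mpeval ` polys_in D. \<forall>x\<in>?S. \<bar>(\<mu> x - \<epsilon> / 2) - f x\<bar> < \<epsilon> / 2"
    using \<epsilon> by (intro Stone_Weierstrass_basic) auto
  then obtain q where q: "q \<in> polys_in D" "\<And>x. x \<in> ?S \<Longrightarrow> \<bar>(\<mu> x - \<epsilon> / 2) - mpeval q x\<bar> < \<epsilon> / 2"
    by blast
  have near: "\<mu> x - \<epsilon> < mpeval q x \<and> mpeval q x < \<mu> x" if x: "x \<in> ?B" for x
  proof -
    \<comment> \<open>Polynomials in \<open>D\<close> separate points only on the smaller box
      \<open>?S\<close>; zeroing the other coordinates leads there without changing \<open>q\<close>
      or \<open>\<mu>\<close>.\<close>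
    define x' where "x' i = (if i \<in> D then x i else 0)" for i
    have "x' \<in> ?S" using x D by (auto simp: coord_box_def x'_def)
    moreover have "mpeval q x' = mpeval q x"
      by (rule mpeval_cong[OF q(1)]) (simp add: x'_def)
    moreover have "\<mu> x' = \<mu> x"
      unfolding \<mu>_def merge_def x'_def by (intro INF_cong arg_cong[of _ _ F]) auto
    ultimately have "\<bar>(\<mu> x - \<epsilon> / 2) - mpeval q x\<bar> < \<epsilon> / 2"
      using q(2)[of x'] by metis
    then show ?thesis unfolding abs_less_iff by linarith
  qed
  show ?thesis
  proof (rule that[OF q(1)])
    fix x assume x: "x \<in> ?B"
    have "\<mu> x \<le> F (merge x x)"
      unfolding \<mu>_def using bdd[of x] x by (intro cINF_lower) auto
    also have "merge x x = x" by (simp add: merge_def fun_eq_iff)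
    finally show "mpeval q x < F x" using near[OF x] by simp
    have "\<mu> x < mpeval q x + \<epsilon>" using near[OF x] by simp
    then have "\<exists>z\<in>?B. F (merge x z) < mpeval q x + \<epsilon>"
      unfolding \<mu>_def using bdd[of x] x B_ne by (subst (asm) cINF_less_iff) auto
    then show "\<exists>z\<in>?B. F (\<lambda>i. if i \<in> D then x i else z i) < mpeval q x + \<epsilon>"
      by (simp add: merge_def[abs_def])
  qed
qed

text \<open>The last summand is bounded below by its minimum over fibres, which depends only on the
  variables shared with a single earlier block, by the running intersection property; a polynomial
  slightly below that minimum is moved to that block.\<close>
lemma split_positive_sum:
  fixes F :: "nat \<Rightarrow> (nat \<Rightarrow> real) \<Rightarrow> real"
  assumes "1 \<le> p"
    and "\<And>l. l \<in> {1..p} \<Longrightarrow> I l \<subseteq> A"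
    and "\<forall>l\<in>{1..p-1}. \<exists>s\<in>{1..l}. I (l + 1) \<inter> (\<Union>r\<in>{1..l}. I r) \<subseteq> I s"
    and "\<And>l. l \<in> {1..p} \<Longrightarrow> continuous_on (coord_box A a b) (F l)"
    and "\<And>l x y. l \<in> {1..p} \<Longrightarrow> (\<And>i. i \<in> I l \<Longrightarrow> x i = y i) \<Longrightarrow> F l x = F l y"
    and ab: "a \<le> 0" "0 \<le> b"
    and "\<And>x. x \<in> coord_box A a b \<Longrightarrow> 0 < (\<Sum>l\<in>{1..p}. F l x)"
  shows "\<exists>q. (\<forall>l\<in>{1..p}. q l \<in> polys_in (I l)) \<and> (\<Sum>l\<in>{1..p}. q l) = 0 \<and>
    (\<forall>l\<in>{1..p}. \<forall>x\<in>coord_box A a b. 0 < F l x + mpeval (q l) x)"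
  using assms(1,2,3,4,5,8)
proof (induction p arbitrary: F rule: dec_induct)
  case base
  show ?case
    using base.prems(5) by (intro exI[of _ "\<lambda>_. 0"]) simp
next
  case (step p)
  let ?B = "coord_box A a b"
  have split_sum: "(\<Sum>l\<in>{1..Suc p}. h l) = (\<Sum>l\<in>{1..p}. h l) + h (Suc p)" for h :: "nat \<Rightarrow> 'a::comm_monoid_add"
    by simp
  define D where "D = I (Suc p) \<inter> (\<Union>r\<in>{1..p}. I r)"
  obtain s where s: "s \<in> {1..p}" "D \<subseteq> I s"
    using bspec[OF step.prems(2), of p] step.hyps(1) by (auto simp: D_def)
  have DA: "D \<subseteq> A" using step.prems(1)[of "Suc p"] by (auto simp: D_def)
  have B_ne: "?B \<noteq> {}" using ab by (auto simp: coord_box_def intro!: exI[of _ "\<lambda>_. 0"])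
  have "continuous_on ?B (\<lambda>x. \<Sum>l\<in>{1..Suc p}. F l x)"
    by (intro continuous_on_sum step.prems(3))
  then obtain x0 where x0: "x0 \<in> ?B"
      "\<And>x. x \<in> ?B \<Longrightarrow> (\<Sum>l\<in>{1..Suc p}. F l x0) \<le> (\<Sum>l\<in>{1..Suc p}. F l x)"
    using continuous_attains_inf[OF compact_coord_box B_ne] by blast
  \<comment> \<open>The minimum of the whole sum is what may be lost when the fibre minimum is
    replaced by a polynomial.\<close>
  define \<epsilon> where "\<epsilon> = (\<Sum>l\<in>{1..Suc p}. F l x0)"
  have \<epsilon>: "0 < \<epsilon>" unfolding \<epsilon>_def by (rule step.prems(5)[OF x0(1)])
  have F_cont: "continuous_on ?B (F (Suc p))" by (intro step.prems(3)) simp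
  obtain q where q: "q \<in> polys_in D"
    and q_less: "\<And>x. x \<in> ?B \<Longrightarrow> mpeval q x < F (Suc p) x"
    and q_near: "\<And>x. x \<in> ?B \<Longrightarrow>
      \<exists>z\<in>?B. F (Suc p) (\<lambda>i. if i \<in> D then x i else z i) < mpeval q x + \<epsilon>"
    using polynomial_below_fibre_min[OF DA F_cont ab \<epsilon>] by blast
  define F' where "F' l x = (if l = s then F l x + mpeval q x else F l x)" for l x
  have F'_sum: "(\<Sum>l\<in>{1..p}. F' l x) = (\<Sum>l\<in>{1..p}. F l x) + mpeval q x" for x
  proof -
    have "(\<Sum>l\<in>{1..p}. F' l x) = (\<Sum>l\<in>{1..p}. F l x + (if l = s then mpeval q x else 0))"
      by (intro sum.cong) (auto simp: F'_def)
    then show ?thesis using s(1) by (simp add: sum.distrib)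
  qed
  have "\<exists>q'. (\<forall>l\<in>{1..p}. q' l \<in> polys_in (I l)) \<and> (\<Sum>l\<in>{1..p}. q' l) = 0 \<and>
    (\<forall>l\<in>{1..p}. \<forall>x\<in>?B. 0 < F' l x + mpeval (q' l) x)"
  proof (rule step.IH)
    show "I l \<subseteq> A" if "l \<in> {1..p}" for l
      using step.prems(1)[of l] that by auto
    show "\<forall>l\<in>{1..p-1}. \<exists>s\<in>{1..l}. I (l + 1) \<inter> (\<Union>r\<in>{1..l}. I r) \<subseteq> I s"
      using step.prems(2) by auto
    show "continuous_on ?B (F' l)" if "l \<in> {1..p}" for l
    proof -
      have "continuous_on ?B (F l)" using that by (intro step.prems(3)) auto
      then show ?thesis
        by (cases "l = s") (auto simp: F'_def[abs_def] intro!: continuous_intros)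
    qed
    show "F' l x = F' l y" if l: "l \<in> {1..p}" and xy: "\<And>i. i \<in> I l \<Longrightarrow> x i = y i" for l x y
    proof -
      have "F l x = F l y" using l xy by (intro step.prems(4)) auto
      moreover have "mpeval q x = mpeval q y" if "l = s"
        using that s(2) xy by (intro mpeval_cong[OF q]) auto
      ultimately show ?thesis by (auto simp: F'_def)
    qed
    show "0 < (\<Sum>l\<in>{1..p}. F' l x)" if x: "x \<in> ?B" for x
    proof -
      obtain z where z: "z \<in> ?B" "F (Suc p) (\<lambda>i. if i \<in> D then x i else z i) < mpeval q x + \<epsilon>"
        using q_near[OF x] by blast
      \<comment> \<open>The earlier summands cannot tell \<open>w\<close> from \<open>x\<close>,
        while the last one sees the nearly minimising point of the fibre. The bound
        \<open>\<epsilon>\<close> for the whole sum at \<open>w\<close> thus bounds the first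
        \<open>p\<close> summands at \<open>x\<close>.\<close>
      define w where "w i = (if i \<in> (\<Union>r\<in>{1..p}. I r) then x i else z i)" for i
      have w: "w \<in> ?B" using x z(1) by (auto simp: coord_box_def w_def)
      have "F l w = F l x" if "l \<in> {1..p}" for l
        using that by (intro step.prems(4)) (auto simp: w_def)
      then have "(\<Sum>l\<in>{1..p}. F l w) = (\<Sum>l\<in>{1..p}. F l x)" by simp
      moreover have "F (Suc p) w = F (Suc p) (\<lambda>i. if i \<in> D then x i else z i)"
        by (intro step.prems(4)) (auto simp: w_def D_def)
      ultimately have "\<epsilon> \<le> (\<Sum>l\<in>{1..p}. F l x) + F (Suc p) (\<lambda>i. if i \<in> D then x i else z i)"
        using x0(2)[OF w] unfolding \<epsilon>_def split_sum[of "\<lambda>l. F l w"] by simp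
      then show ?thesis unfolding F'_sum using z(2) by linarith
    qed
  qed
  then obtain q' where q': "\<And>l. l \<in> {1..p} \<Longrightarrow> q' l \<in> polys_in (I l)" "(\<Sum>l\<in>{1..p}. q' l) = 0"
    "\<And>l x. l \<in> {1..p} \<Longrightarrow> x \<in> ?B \<Longrightarrow> 0 < F' l x + mpeval (q' l) x"
    by blast
  \<comment> \<open>What block \<open>s\<close> receives is taken from the last block, so the
    corrections still cancel.\<close>
  define r where "r l = (if l = Suc p then - q else q' l + (if l = s then q else 0))" for l
  have qD: "q \<in> polys_in (I s)" "q \<in> polys_in (I (Suc p))"
    using q polys_in_mono[OF s(2)] polys_in_mono[of D "I (Suc p)"] by (auto simp: D_def)
  show ?case
  proof (intro exI[of _ r] conjI ballI)
    fix l assume l: "l \<in> {1..Suc p}"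
    then have l': "l = Suc p \<or> l \<in> {1..p}" by auto
    then show "r l \<in> polys_in (I l)"
      using q'(1) qD by (auto simp: r_def intro!: polys_in_uminus polys_in_add)
    fix x assume x: "x \<in> ?B"
    have "mpeval (- q) x = - mpeval q x"
      using mpeval_diff[of 0 q x] by simp
    with l' show "0 < F l x + mpeval (r l) x"
      using q_less[OF x] q'(3)[OF _ x, of l] by (auto simp: r_def F'_def mpeval_add split: if_splits)
  next
    have "(\<Sum>l\<in>{1..p}. r l) = (\<Sum>l\<in>{1..p}. q' l + (if l = s then q else 0))"
      by (intro sum.cong) (auto simp: r_def)
    also have "\<dots> = q"
      using s(1) q'(2) by (simp add: sum.distrib)
    finally show "(\<Sum>l\<in>{1..Suc p}. r l) = 0"
      unfolding split_sum by (simp add: r_def)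
  qed
qed

text \<open>On its own local set the penalty of a block is zero, so the positive function assigned
  to that block is there a polynomial in its variables, to which
  \<open>krivine_representation\<close> applies.\<close>

theorem sparse_krivine_representation:
  fixes fl :: "nat \<Rightarrow> mpoly"
  assumes p: "1 \<le> p" and fl: "\<And>l. l \<in> {1..p} \<Longrightarrow> fl l \<in> polys_in (I l)"
    and g: "\<And>l j. l \<in> {1..p} \<Longrightarrow> j \<in> J l \<Longrightarrow> g j \<in> polys_in (I l)"
    and I: "(\<Union>l\<in>{1..p}. I l) = {1..n}" and J: "(\<Union>l\<in>{1..p}. J l) = {1..m}"
    and rip: "\<forall>l\<in>{1..p-1}. \<exists>s\<in>{1..l}. I (l + 1) \<inter> (\<Union>r\<in>{1..l}. I r) \<subseteq> I s"
    and K: "\<And>l. l \<in> {1..p} \<Longrightarrow> compact (Kloc (I l) (J l) g)"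
    and gen: "\<And>l. l \<in> {1..p} \<Longrightarrow> polys_in (I l) \<subseteq> alg_gen (g ` J l)"
    and pos: "\<And>x. x \<in> Kset n m g \<Longrightarrow> 0 < mpeval (\<Sum>l\<in>{1..p}. fl l) x"
  shows "\<exists>d F. (\<Sum>l\<in>{1..p}. fl l) = (\<Sum>l\<in>{1..p}. F l) \<and> (\<forall>l\<in>{1..p}. F l \<in> hcone m g (J l) d)"
proof -
  have Jl: "finite (J l)" "J l \<subseteq> {1..m}" if "l \<in> {1..p}" for l
    using that J finite_subset[of "J l" "{1..m}"] by blast+
  have "\<exists>R. \<forall>x\<in>Kloc (I l) (J l) g. \<bar>x i\<bar> \<le> R" if "l \<in> {1..p}" for l i
  proof -
    have "continuous_on (Kloc (I l) (J l) g) (\<lambda>x. x i)"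
      by (rule continuous_on_subset[OF continuous_on_product_coordinates]) simp
    then have "bounded ((\<lambda>x. x i) ` Kloc (I l) (J l) g)"
      using K[OF that] by (intro compact_imp_bounded compact_continuous_image)
    then show ?thesis by (auto simp: bounded_iff)
  qed
  then obtain r where r: "\<And>l i x. l \<in> {1..p} \<Longrightarrow> x \<in> Kloc (I l) (J l) g \<Longrightarrow> \<bar>x i\<bar> \<le> r l i"
    by metis
  \<comment> \<open>A crude common radius for all blocks and coordinates; unlike a maximum, the sum
    needs no case distinction for empty index sets.\<close>
  define R where "R = (\<Sum>l\<in>{1..p}. \<Sum>i\<in>{1..n}. \<bar>r l i\<bar>)"
  have R0: "0 \<le> R" unfolding R_def by (intro sum_nonneg) auto
  have rR: "r l i \<le> R" if "l \<in> {1..p}" "i \<in> {1..n}" for l i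
  proof -
    have "r l i \<le> \<bar>r l i\<bar>" by simp
    also have "\<dots> \<le> (\<Sum>i\<in>{1..n}. \<bar>r l i\<bar>)" using that by (intro member_le_sum) auto
    also have "\<dots> \<le> R"
      unfolding R_def using that
      by (intro member_le_sum[of l _ "\<lambda>l. \<Sum>i\<in>{1..n}. \<bar>r l i\<bar>"] sum_nonneg) auto
    finally show ?thesis .
  qed
  let ?B = "coord_box {1..n} (- R) R"
  have KB: "Kloc (I l) (J l) g \<subseteq> ?B" if l: "l \<in> {1..p}" for l
  proof
    fix x assume x: "x \<in> Kloc (I l) (J l) g"
    have "\<bar>x i\<bar> \<le> R" if "i \<in> {1..n}" for i
      using r[OF l x, of i] rR[OF l that] by linarith
    moreover have "x i = 0" if "i \<notin> {1..n}" for i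
      using x I l that by (force simp: Kloc_def)
    ultimately show "x \<in> ?B" by (simp add: coord_box_def abs_le_iff minus_le_iff)
  qed
  \<comment> \<open>The distance of the value of \<open>g j\<close> from the unit interval; it
    depends on no variables beyond those of \<open>g j\<close>, so the penalty of a block stays
    within the block.\<close>
  define pen where "pen j x = max 0 (- mpeval (g j) x) + max 0 (mpeval (g j) x - 1)" for j x
  define \<phi> where "\<phi> l x = (\<Sum>j\<in>J l. pen j x)" for l x
  have pen0: "0 \<le> pen j x" for j x by (simp add: pen_def)
  have pen_zero: "pen j x = 0 \<longleftrightarrow> 0 \<le> mpeval (g j) x \<and> mpeval (g j) x \<le> 1" for j x
    by (auto simp: pen_def max_def)
  have pen_cont: "continuous_on S (pen j)" for S j
    unfolding pen_def by (intro continuous_intros)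
  have \<phi>0: "0 \<le> \<phi> l x" for l x unfolding \<phi>_def by (intro sum_nonneg pen0)
  have \<phi>_cont: "continuous_on S (\<phi> l)" for S l
    unfolding \<phi>_def by (intro continuous_on_sum pen_cont)
  have \<phi>_zero: "\<phi> l x = 0 \<longleftrightarrow> (\<forall>j\<in>J l. 0 \<le> mpeval (g j) x \<and> mpeval (g j) x \<le> 1)"
    if "l \<in> {1..p}" for l x
    unfolding \<phi>_def using Jl(1)[OF that] by (simp add: sum_nonneg_eq_0_iff pen0 pen_zero)
  obtain c where c: "\<And>x. x \<in> ?B \<Longrightarrow>
      0 < mpeval (\<Sum>l\<in>{1..p}. fl l) x + c * (\<Sum>l\<in>{1..p}. \<phi> l x)"
  proof (rule positive_with_penalty)
    show "compact ?B" by (rule compact_coord_box)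
    show "continuous_on ?B (mpeval (\<Sum>l\<in>{1..p}. fl l))" by (rule continuous_on_mpeval)
    show "continuous_on ?B (\<lambda>x. \<Sum>l\<in>{1..p}. \<phi> l x)" by (intro continuous_on_sum \<phi>_cont)
    show "0 \<le> (\<Sum>l\<in>{1..p}. \<phi> l x)" for x by (intro sum_nonneg \<phi>0)
    show "0 < mpeval (\<Sum>l\<in>{1..p}. fl l) x"
      if x: "x \<in> ?B" and zero: "(\<Sum>l\<in>{1..p}. \<phi> l x) = 0" for x
    proof (rule pos)
      have "\<forall>l\<in>{1..p}. \<phi> l x = 0"
        using zero by (subst (asm) sum_nonneg_eq_0_iff) (auto intro: \<phi>0)
      then have "\<forall>l\<in>{1..p}. \<forall>j\<in>J l. 0 \<le> mpeval (g j) x \<and> mpeval (g j) x \<le> 1"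
        using \<phi>_zero by blast
      then have "\<forall>j\<in>{1..m}. 0 \<le> mpeval (g j) x \<and> mpeval (g j) x \<le> 1"
        using J by blast
      then show "x \<in> Kset n m g"
        using x unfolding Kset_def coord_box_def by blast
    qed
  qed blast
  have "\<exists>q. (\<forall>l\<in>{1..p}. q l \<in> polys_in (I l)) \<and> (\<Sum>l\<in>{1..p}. q l) = 0 \<and>
    (\<forall>l\<in>{1..p}. \<forall>x\<in>?B. 0 < (mpeval (fl l) x + c * \<phi> l x) + mpeval (q l) x)"
  proof (rule split_positive_sum[OF p _ rip])
    show "I l \<subseteq> {1..n}" if "l \<in> {1..p}" for l using I that by blast
    show "continuous_on ?B (\<lambda>x. mpeval (fl l) x + c * \<phi> l x)" for l
      by (intro continuous_intros continuous_on_mpeval \<phi>_cont)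
    show "mpeval (fl l) x + c * \<phi> l x = mpeval (fl l) y + c * \<phi> l y"
      if l: "l \<in> {1..p}" and xy: "\<And>i. i \<in> I l \<Longrightarrow> x i = y i" for l x y
    proof -
      have "pen j x = pen j y" if "j \<in> J l" for j
        unfolding pen_def using mpeval_cong[OF g[OF l that], of x y] xy by simp
      then have "\<phi> l x = \<phi> l y" unfolding \<phi>_def by (intro sum.cong) auto
      moreover have "mpeval (fl l) x = mpeval (fl l) y" by (rule mpeval_cong[OF fl[OF l] xy])
      ultimately show ?thesis by simp
    qed
    show "0 < (\<Sum>l\<in>{1..p}. mpeval (fl l) x + c * \<phi> l x)" if "x \<in> ?B" for x
      using c[OF that] by (simp add: mpeval_sum sum.distrib sum_distrib_left)
  qed (use R0 in auto)
  then obtain q where q: "\<And>l. l \<in> {1..p} \<Longrightarrow> q l \<in> polys_in (I l)" "(\<Sum>l\<in>{1..p}. q l) = 0"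
    "\<And>l x. l \<in> {1..p} \<Longrightarrow> x \<in> ?B \<Longrightarrow> 0 < (mpeval (fl l) x + c * \<phi> l x) + mpeval (q l) x"
    by blast
  have "\<exists>d. fl l + q l \<in> hcone m g (J l) d" if l: "l \<in> {1..p}" for l
  proof (rule krivine_representation)
    show "fl l + q l \<in> polys_in (I l)" using fl q(1) l by (intro polys_in_add)
    fix x assume x: "x \<in> Kloc (I l) (J l) g"
    then have "\<phi> l x = 0" using \<phi>_zero[OF l] by (simp add: Kloc_def)
    then show "0 < mpeval (fl l + q l) x"
      using q(3)[OF l subsetD[OF KB[OF l] x]] by (simp add: mpeval_add)
  qed (use l Jl g gen in auto)
  then obtain d where d: "\<And>l. l \<in> {1..p} \<Longrightarrow> fl l + q l \<in> hcone m g (J l) (d l)"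
    by metis
  have "fl l + q l \<in> hcone m g (J l) (\<Sum>l\<in>{1..p}. d l)" if l: "l \<in> {1..p}" for l
    using subsetD[OF hcone_mono d[OF l]] Jl(1)[OF l] member_le_sum[of l "{1..p}" d] l by simp
  moreover have "(\<Sum>l\<in>{1..p}. fl l) = (\<Sum>l\<in>{1..p}. fl l + q l)"
    using q(2) by (simp add: sum.distrib)
  ultimately show ?thesis by blast
qed

subsection \<open>Convergence of the hierarchy\<close>

theorem mainTheorem3:
  fixes n m p k :: nat and I J :: "nat \<Rightarrow> nat set" and f :: mpoly and g :: "nat \<Rightarrow> mpoly"
  assumes f_vars: "f \<in> polys_in {1..n}"
    and g_vars: "\<forall>j\<in>{1..m}. g j \<in> polys_in {1..n}"
    and sp_f: "\<exists>fl :: nat \<Rightarrow> mpoly. f = (\<Sum>l\<in>{1..p}. fl l) \<and> (\<forall>l\<in>{1..p}. fl l \<in> polys_in (I l))"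
    and sp_g: "\<forall>l\<in>{1..p}. \<forall>j\<in>J l. g j \<in> polys_in (I l)"
    and sp_I: "(\<Union>l\<in>{1..p}. I l) = {1..n}"
    and sp_J: "(\<Union>l\<in>{1..p}. J l) = {1..m}"
    and sp_rip: "\<forall>l\<in>{1..p-1}. \<exists>s\<in>{1..l}. I (l + 1) \<inter> (\<Union>r\<in>{1..l}. I r) \<subseteq> I s"
    and comp_a: "\<forall>l\<in>{1..p}. compact (Kloc (I l) (J l) g)
                   \<and> polys_in (I l) \<subseteq> alg_gen (g ` J l)"
    and comp_b: "\<forall>l\<in>{1..p}. \<exists>M>0. \<exists>j\<in>J l.
                   g j = 1 - mconst (1 / M) * (\<Sum>i\<in>I l. mvar i * mvar i)"
  shows "mono (\<lambda>d. qkd m p I J f g k d) \<and> (\<lambda>d. qkd m p I J f g k d) \<longlonglongrightarrow> fstar n m f g"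
proof
  have J: "J l \<subseteq> {1..m}" "finite (J l)" if "l \<in> {1..p}" for l
    using that sp_J finite_subset[of "J l" "{1..m}"] by blast+
  show mono: "mono (\<lambda>d. qkd m p I J f g k d)"
    using mono_qkd[OF J(2)] by simp
  obtain fl where fl: "f = (\<Sum>l\<in>{1..p}. fl l)" "\<And>l. l \<in> {1..p} \<Longrightarrow> fl l \<in> polys_in (I l)"
    using sp_f by blast
  have reach: "\<exists>d. ereal t \<le> qkd m p I J f g k d" if t: "ereal t < fstar n m f g" for t
  \<comment> \<open>Without blocks there are neither variables nor constraints: \<open>f\<close> is
    0 and \<open>Kset\<close> consists of the zero point.\<close>
  proof (cases "p = 0")
    case True
    then have [simp]: "n = 0" "m = 0" "f = 0" using sp_I sp_J fl(1) by auto
    have "fstar n m f g \<le> ereal (mpeval f (\<lambda>_. 0))"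
      unfolding fstar_def by (intro Inf_lower) (auto simp: Kset_def)
    from order.strict_trans2[OF t this] have "t \<le> 0" by simp
    moreover have "ereal 0 \<le> qkd m p I J f g k 0"
      using True by (intro qkd_lower_bound[where F = "\<lambda>_. 0"]) auto
    ultimately show ?thesis by (meson ereal_less_eq(3) order_trans)
  next
    case False
    \<comment> \<open>The constant is charged to a single block, so that it is subtracted only once
      from the sum.\<close>
    define fl' where "fl' l = fl l - (if l = 1 then mconst t else 0)" for l
    have sum: "(\<Sum>l\<in>{1..p}. fl' l) = f - mconst t"
      using False by (simp add: fl'_def fl(1) sum_subtractf)
    have pos: "0 < mpeval (\<Sum>l\<in>{1..p}. fl' l) x" if "x \<in> Kset n m g" for x
    proof -
      have "fstar n m f g \<le> ereal (mpeval f x)"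
        unfolding fstar_def using that by (intro Inf_lower) auto
      from order.strict_trans2[OF t this] show ?thesis unfolding sum by (simp add: mpeval_diff)
    qed
    have "\<exists>d F. (\<Sum>l\<in>{1..p}. fl' l) = (\<Sum>l\<in>{1..p}. F l) \<and>
        (\<forall>l\<in>{1..p}. F l \<in> hcone m g (J l) d)"
    proof (rule sparse_krivine_representation[OF _ _ _ sp_I sp_J sp_rip _ _ pos])
      show "fl' l \<in> polys_in (I l)" if "l \<in> {1..p}" for l
        unfolding fl'_def using fl(2)[OF that] by (intro polys_in_diff) auto
    qed (use False sp_g comp_a in auto)
    then obtain d F where "f - mconst t = (\<Sum>l\<in>{1..p}. F l)"
      "\<And>l. l \<in> {1..p} \<Longrightarrow> F l \<in> hcone m g (J l) d"
      unfolding sum by blast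
    then have "ereal t \<le> qkd m p I J f g k d"
      using J(1) sp_g by (intro qkd_lower_bound) auto
    then show ?thesis ..
  qed
  have "(SUP d. qkd m p I J f g k d) = fstar n m f g"
  proof (rule antisym)
    show "(SUP d. qkd m p I J f g k d) \<le> fstar n m f g"
      by (intro SUP_least qkd_le_fstar)
    show "fstar n m f g \<le> (SUP d. qkd m p I J f g k d)"
    \<comment> \<open>Working with real \<open>t\<close> below \<open>fstar\<close> also covers an
      empty \<open>Kset\<close>, where \<open>fstar\<close> is infinite and every real
      \<open>t\<close> is reached.\<close>
    proof (rule dense_le)
      fix u assume "u < fstar n m f g"
      then obtain t where t: "u < ereal t" "ereal t < fstar n m f g"
        using ereal_dense2 by blast
      obtain d where "ereal t \<le> qkd m p I J f g k d" using reach[OF t(2)] ..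
      also have "\<dots> \<le> (SUP d. qkd m p I J f g k d)" by (rule SUP_upper) simp
      finally show "u \<le> (SUP d. qkd m p I J f g k d)" using t(1) by simp
    qed
  qed
  then show "(\<lambda>d. qkd m p I J f g k d) \<longlonglongrightarrow> fstar n m f g"
    using LIMSEQ_SUP[of "\<lambda>d. qkd m p I J f g k d"] mono by simp
qed

end
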